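(* Let $\kappa<0$ and let $\alpha$ be a complete curve in the hyperbolic plane $\mathbb{H}^2(\kappa)$ of constant curvature $\kappa$, with constant geodesic curvature $\kappa_g$ satisfying $\kappa_g^2+\kappa\le 0$. Let $\mathsf{C}_\alpha=\alpha\times\mathbb{R}$ be the vertical constant mean curvature cylinder over $\alpha$ in $\mathbb{H}^2(\kappa)\times\mathbb{R}$. Then for any $L>0$ the truncated cylinder $\mathsf{C}_\alpha(L)=\{(p,z)\in\mathsf{C}_\alpha: 0\le z\le L\}$ is strongly stable on $\Pi_0\cup\Pi_L$ in the partitioning problem, where $\Pi_c=\mathbb{H}^2(\kappa)\times\{c\}$.
   Context: $\mathbb{H}^2(\kappa)\times\mathbb{R}$ carries the product metric, with $z$ the coordinate on $\mathbb{R}$. A vertical cylinder over a curve $\alpha\subset\mathbb{H}^2(\kappa)$ is $\mathsf{C}_\alpha=\pi^{-1}(\alpha)=\alpha\times\mathbb{R}$, where $\pi$ is the projection onto $\mathbb{H}^2(\kappa)$; its mean curvature is $\kappa_g/2$. It meets every $\Pi_c$ orthogonally, so $\mathsf{C}_\alpha(L)$ is a capillary surface in the domain $W=\{0\le z\le L\}$ with contact angle $\gamma=\pi/2$. **Partitioning problem and strong stability.** Let $W$ be a domain with smooth boundary $S=\partial W$ (here $S=\Pi_0\cup\Pi_L$). Let $\Sigma$ be an oriented surface with $\mathrm{int}(\Sigma)\subset\mathrm{int}(W)$, $\partial\Sigma\subset S$, separating $W$ into two components; fix one of them, $D$, and put $\Omega=\partial D\cap S$. $\Sigma$ is a capillary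 surface if it has constant mean curvature and makes a constant contact angle $\gamma\in(0,\pi)$ with $S$ along $\partial\Sigma$, where $\cos\gamma=\langle N,\widetilde N\rangle$, $N$ being the unit normal of $\Sigma$ pointing into $D$ and $\widetilde N$ the unit normal of $S$ pointing out of $D$. Capillary surfaces are critical points of $\mathrm{Area}(\Sigma_t)-\cos\gamma\,\mathrm{Area}(\Omega(t))$ under volume preserving (compactly supported) variations with $\partial\Sigma_t\subset S$, and the second variation is $$\mathcal{E}''(0)[u]=-\int_\Sigma u\,\mathcal{L}[u]+\int_{\partial\Sigma}u\Big(\frac{\partial u}{\partial\nu}-\mathbf{q}\,u\Big),\qquad \mathbf{q}=\frac{1}{\sin\gamma}\widetilde A(\widetilde\nu,\widetilde\nu)+\frac{\cos\gamma}{\sin\gamma}A(\nu,\nu).$$ Here $\mathcal{L}=\Delta+|A|^2+\mathrm{Ric}(N)$, with $\Delta$ the Laplacian of $\Sigma$, $A$ its second fundamental form, $\mathrm{Ric}(N)$ the ambient Ricci curvature in the direction $N$; $\widetilde A$ is the second fundamental form of $S$ with respect to $-\widetilde N$; and $\nu,\widetilde\nu$ are the exterior unit conormals of $\partial\Sigma$ in $\Sigma$ and in $S$ (exterior to $\Omega$), respectively. The capillary surface $\Sigma$ is strongly stable in the partitioning problem if $\mathcal{E}''(0)[u]\ge 0$ for every smooth function $u$ with compact support on $\Sigma$, where $\Sigma$ includes its boundary $\partial\Sigma$ (so $u$ need not vanish on $\partial\Sigma$) and no condition on $\int_\Sigma u$ is imposed. *)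

theory Defs
  imports "HOL-Analysis.Analysis"
begin

section \<open>Smooth maps\<close>

fun iter_deriv ::
  "'a::real_normed_vector list \<Rightarrow> ('a \<Rightarrow> 'b::real_normed_vector) \<Rightarrow> 'a \<Rightarrow> 'b" where
  "iter_deriv [] f = f"
| "iter_deriv (v # vs) f = iter_deriv vs (\<lambda>x. frechet_derivative f (at x) v)"

text \<open>On an open set of a Euclidean space this is \<open>C\<^sup>\<infinity>\<close>: all iterated directional
  derivatives exist and are differentiable, hence continuous.\<close>

definition smooth_on ::
  "'a::euclidean_space set \<Rightarrow> ('a \<Rightarrow> 'b::real_normed_vector) \<Rightarrow> bool" where
  "smooth_on V f \<longleftrightarrow> open V \<and> (\<forall>vs. \<forall>x\<in>V. iter_deriv vs f differentiable (at x))"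

text \<open>Smoothness up to the boundary on a set \<open>P\<close> that need not be open.  On a set that lies in the
  closure of its interior, the derivatives at points of \<open>P\<close> do not depend on the extension.\<close>

definition smooth_near ::
  "'a::euclidean_space set \<Rightarrow> ('a \<Rightarrow> 'b::real_normed_vector) \<Rightarrow> bool" where
  "smooth_near P f \<longleftrightarrow> (\<exists>V. P \<subseteq> V \<and> smooth_on V f)"

section \<open>Riemannian geometry on open subsets of a Euclidean space\<close>

text \<open>\<open>g p v w\<close> is the inner product of the tangent vectors \<open>v\<close> and \<open>w\<close> at \<open>p\<close>.  Tangent vectors
  are elements of the ambient vector space; its own inner product \<open>\<bullet>\<close> serves only to
  write down traces of linear maps.\<close>

type_synonym 'a riem = "'a \<Rightarrow> 'a \<Rightarrow> 'a \<Rightarrow> real"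

text \<open>The vector dual to the linear form \<open>\<phi>\<close>.\<close>

definition sharp :: "'a riem \<Rightarrow> 'a \<Rightarrow> ('a \<Rightarrow> real) \<Rightarrow> 'a" where
  "sharp g p \<phi> = (THE x. \<forall>y. g p x y = \<phi> y)"

definition trace_of :: "('a::euclidean_space \<Rightarrow> 'a) \<Rightarrow> real" where
  "trace_of F = (\<Sum>b\<in>Basis. F b \<bullet> b)"

text \<open>Levi-Civita connection, by the Koszul formula for constant vector fields:
  \<open>christoffel g p v w\<close> is \<open>\<nabla>\<^sub>v w\<close> at \<open>p\<close> with \<open>w\<close> extended as a constant field.\<close>

definition christoffel :: "'a::euclidean_space riem \<Rightarrow> 'a \<Rightarrow> 'a \<Rightarrow> 'a \<Rightarrow> 'a" where
  "christoffel g p v w = sharp g p (\<lambda>x.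
     (frechet_derivative (\<lambda>p'. g p' w x) (at p) v
      + frechet_derivative (\<lambda>p'. g p' v x) (at p) w
      - frechet_derivative (\<lambda>p'. g p' v w) (at p) x) / 2)"

text \<open>Covariant derivative, in the parameter direction \<open>v\<close>, of a vector field \<open>Y\<close> along a map \<open>X\<close>;
  for \<open>X\<close> the identity it is the covariant derivative of the vector field \<open>Y\<close>.\<close>

definition covd :: "'b::euclidean_space riem \<Rightarrow> ('a::euclidean_space \<Rightarrow> 'b) \<Rightarrow> ('a \<Rightarrow> 'b)
    \<Rightarrow> 'a \<Rightarrow> 'a \<Rightarrow> 'b" where
  "covd g X Y q v = frechet_derivative Y (at q) v
     + christoffel g (X q) (frechet_derivative X (at q) v) (Y q)"

text \<open>\<open>riemann g p x v w = \<nabla>\<^sub>x \<nabla>\<^sub>v w - \<nabla>\<^sub>v \<nabla>\<^sub>x w\<close> for constant fields \<open>x\<close>, \<open>v\<close>, \<open>w\<close>.\<close>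

definition riemann :: "'a::euclidean_space riem \<Rightarrow> 'a \<Rightarrow> 'a \<Rightarrow> 'a \<Rightarrow> 'a \<Rightarrow> 'a" where
  "riemann g p x v w =
     frechet_derivative (\<lambda>p'. christoffel g p' v w) (at p) x
     - frechet_derivative (\<lambda>p'. christoffel g p' x w) (at p) v
     + christoffel g p x (christoffel g p v w)
     - christoffel g p v (christoffel g p x w)"

definition Ric :: "'a::euclidean_space riem \<Rightarrow> 'a \<Rightarrow> 'a \<Rightarrow> real" where
  "Ric g p v = trace_of (\<lambda>x. riemann g p x v v)"

definition gradient :: "'a::euclidean_space riem \<Rightarrow> ('a \<Rightarrow> real) \<Rightarrow> 'a \<Rightarrow> 'a" where
  "gradient h u q = sharp h q (frechet_derivative u (at q))"

definition laplacian :: "'a::euclidean_space riem \<Rightarrow> ('a \<Rightarrow> real) \<Rightarrow> 'a \<Rightarrow> real" where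
  "laplacian h u q = trace_of (covd h (\<lambda>q. q) (gradient h u) q)"

section \<open>Immersed hypersurfaces\<close>

text \<open>An immersion \<open>X\<close> of a parameter domain is used to transport the geometry of the surface to
  the parameter domain: functions and tangent vectors of the surface are functions and
  vectors on the parameter domain.\<close>

definition first_ff :: "'b riem \<Rightarrow> ('a::euclidean_space \<Rightarrow> 'b::euclidean_space) \<Rightarrow> 'a riem" where
  "first_ff g X q v w =
     g (X q) (frechet_derivative X (at q) v) (frechet_derivative X (at q) w)"

text \<open>Second fundamental form with respect to the unit normal field \<open>n\<close> along \<open>X\<close>; it equals
  \<open>g (\<nabla>\<^sub>v dX(w)) n\<close>, so that spheres with inner normal have positive curvature.\<close>

definition second_ff :: "'b riem \<Rightarrow> ('a::euclidean_space \<Rightarrow> 'b::euclidean_space) \<Rightarrow> ('a \<Rightarrow> 'b)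
    \<Rightarrow> 'a riem" where
  "second_ff g X n q v w = - g (X q) (covd g X n q v) (frechet_derivative X (at q) w)"

definition shape_op :: "'b riem \<Rightarrow> ('a::euclidean_space \<Rightarrow> 'b::euclidean_space) \<Rightarrow> ('a \<Rightarrow> 'b)
    \<Rightarrow> 'a \<Rightarrow> 'a \<Rightarrow> 'a" where
  "shape_op g X n q v = sharp (first_ff g X) q (second_ff g X n q v)"

definition mean_curvature ::
  "'b riem \<Rightarrow> (real \<times> real \<Rightarrow> 'b::euclidean_space) \<Rightarrow> (real \<times> real \<Rightarrow> 'b) \<Rightarrow> real \<times> real \<Rightarrow> real" where
  "mean_curvature g X n q = trace_of (shape_op g X n q) / 2"

definition norm_sff_sq :: "'b riem \<Rightarrow> ('a::euclidean_space \<Rightarrow> 'b::euclidean_space) \<Rightarrow> ('a \<Rightarrow> 'b)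
    \<Rightarrow> 'a \<Rightarrow> real" where
  "norm_sff_sq g X n q = trace_of (shape_op g X n q \<circ> shape_op g X n q)"

definition jacobi_op :: "'b riem \<Rightarrow> ('a::euclidean_space \<Rightarrow> 'b::euclidean_space) \<Rightarrow> ('a \<Rightarrow> 'b)
    \<Rightarrow> ('a \<Rightarrow> real) \<Rightarrow> 'a \<Rightarrow> real" where
  "jacobi_op g X n u q =
     laplacian (first_ff g X) u q + (norm_sff_sq g X n q + Ric g (X q) (n q)) * u q"

definition area_density :: "(real \<times> real) riem \<Rightarrow> real \<times> real \<Rightarrow> real" where
  "area_density h q = sqrt (h q (1, 0) (1, 0) * h q (0, 1) (0, 1) - (h q (1, 0) (0, 1))\<^sup>2)"

section \<open>The partitioning problem for surfaces of strip type\<close>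

text \<open>Capillary surfaces with boundary are embeddings of \<open>strip l\<close>, whose boundary is
  \<open>strip_bd l\<close>.\<close>

definition strip :: "real \<Rightarrow> (real \<times> real) set" where
  "strip l = UNIV \<times> {0..l}"

definition strip_bd :: "real \<Rightarrow> (real \<times> real) set" where
  "strip_bd l = UNIV \<times> {0, l}"

text \<open>Exterior unit conormal of the boundary at a point \<open>q\<close> of \<open>strip_bd l\<close>, as a vector on the
  parameter domain.\<close>

definition conormal :: "(real \<times> real) riem \<Rightarrow> real \<Rightarrow> real \<times> real \<Rightarrow> real \<times> real" where
  "conormal h l q = (THE v. h q v v = 1 \<and> h q v (1, 0) = 0 \<and>
     (if snd q = l then snd v > 0 else snd v < 0))"

definition embedded_strip ::
  "(real \<times> real \<Rightarrow> 'b::euclidean_space) \<Rightarrow> real \<Rightarrow> bool" where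
  "embedded_strip X l \<longleftrightarrow> smooth_near (strip l) X
     \<and> (\<forall>q\<in>strip l. inj (frechet_derivative X (at q)))
     \<and> (\<exists>Y. homeomorphism (strip l) (X ` strip l) X Y)"

text \<open>Boundary of \<open>W\<close> relative to the open set \<open>M\<close> that carries the ambient metric.\<close>

definition bd_in :: "'b::euclidean_space set \<Rightarrow> 'b set \<Rightarrow> 'b set" where
  "bd_in M W = M \<inter> frontier W"

definition tangent_vector :: "'b::euclidean_space set \<Rightarrow> 'b \<Rightarrow> 'b \<Rightarrow> bool" where
  "tangent_vector S p v \<longleftrightarrow> (\<exists>c. c 0 = p \<and> (c has_vector_derivative v) (at 0) \<and>
     (\<forall>\<^sub>F t in at (0::real). c t \<in> S))"

text \<open>The unit normal \<open>Nt\<close> of the boundary pointing out of \<open>W\<close>; since \<open>D \<subseteq> W\<close>, it is the unit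
  normal of \<open>S\<close> that points out of \<open>D\<close>.  \<open>Nt\<close> is given as a smooth field near \<open>S\<close>; only its
  values on \<open>S\<close> and its derivatives tangent to \<open>S\<close> are used.\<close>

definition outward_unit_normal ::
  "'b::euclidean_space riem \<Rightarrow> 'b set \<Rightarrow> 'b set \<Rightarrow> ('b \<Rightarrow> 'b) \<Rightarrow> bool" where
  "outward_unit_normal g M W Nt \<longleftrightarrow> smooth_near (bd_in M W) Nt \<and>
     (\<forall>p\<in>bd_in M W. g p (Nt p) (Nt p) = 1
        \<and> (\<forall>v. tangent_vector (bd_in M W) p v \<longrightarrow> g p (Nt p) v = 0)
        \<and> (\<forall>\<^sub>F t in at_right (0::real). p + t *\<^sub>R Nt p \<notin> W \<and> p - t *\<^sub>R Nt p \<in> W))"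

text \<open>\<open>v\<close> is the unit vector at \<open>p\<close> that is tangent to \<open>S\<close>, orthogonal to the tangent vector
  \<open>\<tau>\<close> of the boundary curve of \<open>\<Omega> \<subseteq> S\<close>, and points out of \<open>\<Omega>\<close>.\<close>

definition exterior_conormal_in ::
  "'b::euclidean_space riem \<Rightarrow> 'b set \<Rightarrow> 'b set \<Rightarrow> 'b \<Rightarrow> 'b \<Rightarrow> 'b \<Rightarrow> bool" where
  "exterior_conormal_in g S \<Omega> p \<tau> v \<longleftrightarrow> g p v v = 1 \<and> g p v \<tau> = 0 \<and>
     (\<exists>c. c 0 = p \<and> (c has_vector_derivative v) (at 0) \<and>
        (\<forall>\<^sub>F t in at (0::real). c t \<in> S \<and> (c t \<in> \<Omega> \<longleftrightarrow> t \<le> 0)))"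

text \<open>\<open>N\<close>, \<open>Nt\<close> are the unit normals of the surface and of \<open>S\<close>, \<open>\<nu>t\<close> is the conormal of the boundary
  in \<open>S\<close>.  Given \<open>D\<close>, the requirements determine \<open>N\<close> on the strip, \<open>Nt\<close> on \<open>S\<close>, \<open>\<nu>t\<close> on the boundary
  of the strip, and the contact angle \<open>\<gamma>\<close>.  That \<open>N\<close> points into \<open>D\<close> is required at
  interior points; on the boundary \<open>N\<close> is then fixed by continuity.\<close>

definition capillary_surface ::
  "'b::euclidean_space riem \<Rightarrow> 'b set \<Rightarrow> 'b set \<Rightarrow> (real \<times> real \<Rightarrow> 'b) \<Rightarrow> real \<Rightarrow> 'b set
    \<Rightarrow> (real \<times> real \<Rightarrow> 'b) \<Rightarrow> ('b \<Rightarrow> 'b) \<Rightarrow> (real \<times> real \<Rightarrow> 'b) \<Rightarrow> real \<Rightarrow> bool" where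
  "capillary_surface g M W X l D N Nt \<nu>t \<gamma> \<longleftrightarrow>
     embedded_strip X l
     \<and> X ` (strip l - strip_bd l) \<subseteq> interior W
     \<and> X ` strip_bd l \<subseteq> bd_in M W
     \<and> card (components (W - X ` strip l)) = 2
     \<and> D \<in> components (W - X ` strip l)
     \<and> smooth_near (strip l) N
     \<and> (\<forall>q\<in>strip l. g (X q) (N q) (N q) = 1
          \<and> (\<forall>v. g (X q) (N q) (frechet_derivative X (at q) v) = 0))
     \<and> (\<forall>q\<in>strip l - strip_bd l. \<forall>\<^sub>F t in at_right (0::real). X q + t *\<^sub>R N q \<in> D)
     \<and> outward_unit_normal g M W Nt
     \<and> (\<forall>q\<in>strip_bd l. exterior_conormal_in g (bd_in M W) (frontier D \<inter> bd_in M W) (X q)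
          (frechet_derivative X (at q) (1, 0)) (\<nu>t q))
     \<and> (\<exists>H. \<forall>q\<in>strip l. mean_curvature g X N q = H)
     \<and> 0 < \<gamma> \<and> \<gamma> < pi
     \<and> (\<forall>q\<in>strip_bd l. g (X q) (N q) (Nt (X q)) = cos \<gamma>)"

definition q_coeff ::
  "'b::euclidean_space riem \<Rightarrow> (real \<times> real \<Rightarrow> 'b) \<Rightarrow> real \<Rightarrow> (real \<times> real \<Rightarrow> 'b)
    \<Rightarrow> ('b \<Rightarrow> 'b) \<Rightarrow> (real \<times> real \<Rightarrow> 'b) \<Rightarrow> real \<Rightarrow> real \<times> real \<Rightarrow> real" where
  "q_coeff g X l N Nt \<nu>t \<gamma> q =
     1 / sin \<gamma> * second_ff g (\<lambda>p. p) (\<lambda>p. - Nt p) (X q) (\<nu>t q) (\<nu>t q)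
     + cos \<gamma> / sin \<gamma> *
         second_ff g X N q (conormal (first_ff g X) l q) (conormal (first_ff g X) l q)"

definition second_variation ::
  "'b::euclidean_space riem \<Rightarrow> (real \<times> real \<Rightarrow> 'b) \<Rightarrow> real \<Rightarrow> (real \<times> real \<Rightarrow> 'b)
    \<Rightarrow> ('b \<Rightarrow> 'b) \<Rightarrow> (real \<times> real \<Rightarrow> 'b) \<Rightarrow> real \<Rightarrow> (real \<times> real \<Rightarrow> real) \<Rightarrow> real" where
  "second_variation g X l N Nt \<nu>t \<gamma> u =
     (let h = first_ff g X in
       - (LINT q:strip l|lborel. u q * jacobi_op g X N u q * area_density h q)
       + (\<Sum>t\<in>{0, l}. LINT s|lborel.
            u (s, t) * (frechet_derivative u (at (s, t)) (conormal h l (s, t))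
                        - q_coeff g X l N Nt \<nu>t \<gamma> (s, t) * u (s, t))
            * sqrt (h (s, t) (1, 0) (1, 0))))"

text \<open>The test functions need not vanish on the boundary and need not have mean value zero.\<close>

definition test_function :: "real \<Rightarrow> (real \<times> real \<Rightarrow> real) \<Rightarrow> bool" where
  "test_function l u \<longleftrightarrow> smooth_near (strip l) u
     \<and> (\<exists>K. compact K \<and> (\<forall>q\<in>strip l - K. u q = 0))"

text \<open>The surface \<open>\<Sigma>\<close> is parametrised by \<open>X\<close>; stability is asked for both choices of the
  component \<open>D\<close>.\<close>

definition strongly_stable ::
  "'b::euclidean_space riem \<Rightarrow> 'b set \<Rightarrow> 'b set \<Rightarrow> 'b set \<Rightarrow> (real \<times> real \<Rightarrow> 'b) \<Rightarrow> real \<Rightarrow> bool" where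
  "strongly_stable g M W \<Sigma> X l \<longleftrightarrow>
     X ` strip l = \<Sigma> \<and> card (components (W - \<Sigma>)) = 2
     \<and> (\<forall>D\<in>components (W - \<Sigma>). \<exists>N Nt \<nu>t \<gamma>. capillary_surface g M W X l D N Nt \<nu>t \<gamma>
          \<and> (\<forall>u. test_function l u \<longrightarrow> 0 \<le> second_variation g X l N Nt \<nu>t \<gamma> u))"

section \<open>The hyperbolic plane and its product with the line\<close>

text \<open>Upper half-plane model; for \<open>\<kappa> < 0\<close> the metric \<open>(dx\<^sup>2 + dy\<^sup>2) / (- \<kappa> y\<^sup>2)\<close> has curvature \<open>\<kappa>\<close>.\<close>

definition hyp_plane :: "complex set" where
  "hyp_plane = {p. Im p > 0}"

definition hyp_metric :: "real \<Rightarrow> complex riem" where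
  "hyp_metric \<kappa> p v w = (v \<bullet> w) / (- \<kappa> * (Im p)\<^sup>2)"

definition product_space :: "(complex \<times> real) set" where
  "product_space = hyp_plane \<times> UNIV"

definition product_metric :: "real \<Rightarrow> (complex \<times> real) riem" where
  "product_metric \<kappa> p v w = hyp_metric \<kappa> (fst p) (fst v) (fst w) + snd v * snd w"

definition horizontal_slice :: "real \<Rightarrow> (complex \<times> real) set" where
  "horizontal_slice c = hyp_plane \<times> {c}"

definition slab :: "real \<Rightarrow> (complex \<times> real) set" where
  "slab L = hyp_plane \<times> {0..L}"

lemma bd_slab:
  assumes "0 < L"
  shows "bd_in product_space (slab L) = horizontal_slice 0 \<union> horizontal_slice L"
proof -
  have "open hyp_plane"
    unfolding hyp_plane_def by (rule open_halfspace_Im_gt)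
  then have "interior (slab L) = hyp_plane \<times> {0<..<L}"
    by (simp add: slab_def interior_Times interior_open)
  moreover have "closure (slab L) = closure hyp_plane \<times> {0..L}"
    by (simp add: slab_def closure_Times)
  ultimately show ?thesis
    using assms closure_subset[of hyp_plane]
    by (auto simp: bd_in_def frontier_def product_space_def horizontal_slice_def)
qed

section \<open>Curves in the hyperbolic plane and cylinders\<close>

definition regular_curve :: "(real \<Rightarrow> complex) \<Rightarrow> bool" where
  "regular_curve \<alpha> \<longleftrightarrow> smooth_on UNIV \<alpha> \<and> range \<alpha> \<subseteq> hyp_plane
     \<and> (\<forall>s. vector_derivative \<alpha> (at s) \<noteq> 0)"

definition speed :: "real \<Rightarrow> (real \<Rightarrow> complex) \<Rightarrow> real \<Rightarrow> real" where
  "speed \<kappa> \<alpha> s =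
     sqrt (hyp_metric \<kappa> (\<alpha> s) (vector_derivative \<alpha> (at s)) (vector_derivative \<alpha> (at s)))"

text \<open>Completeness of the parameter line with the distance given by the length of the curve;
  no parametrisation by arc length is assumed.\<close>

definition complete_curve :: "real \<Rightarrow> (real \<Rightarrow> complex) \<Rightarrow> bool" where
  "complete_curve \<kappa> \<alpha> \<longleftrightarrow>
     Metric_space.mcomplete UNIV (\<lambda>s t. integral {min s t..max s t} (speed \<kappa> \<alpha>))"

text \<open>The unit normal is \<open>\<i> \<alpha>' / \<bar>\<alpha>'\<bar>\<close>: multiplication by \<open>\<i>\<close> is the rotation by a right
  angle because the metric is conformal.\<close>

definition geodesic_curvature :: "real \<Rightarrow> (real \<Rightarrow> complex) \<Rightarrow> real \<Rightarrow> real" where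
  "geodesic_curvature \<kappa> \<alpha> s =
     (let \<alpha>' = (\<lambda>s. vector_derivative \<alpha> (at s)) in
       hyp_metric \<kappa> (\<alpha> s) (covd (hyp_metric \<kappa>) \<alpha> \<alpha>' s 1) (\<i> * \<alpha>' s) / speed \<kappa> \<alpha> s ^ 3)"

definition vertical_cylinder :: "(real \<Rightarrow> complex) \<Rightarrow> (complex \<times> real) set" where
  "vertical_cylinder \<alpha> = range \<alpha> \<times> UNIV"

definition truncated_cylinder :: "(real \<Rightarrow> complex) \<Rightarrow> real \<Rightarrow> (complex \<times> real) set" where
  "truncated_cylinder \<alpha> L = {(p, z). (p, z) \<in> vertical_cylinder \<alpha> \<and> 0 \<le> z \<and> z \<le> L}"

definition cylinder_param :: "(real \<Rightarrow> complex) \<Rightarrow> real \<times> real \<Rightarrow> complex \<times> real" where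
  "cylinder_param \<alpha> q = (\<alpha> (fst q), snd q)"

lemma cylinder_param_image: "cylinder_param \<alpha> ` strip L = truncated_cylinder \<alpha> L"
  by (force simp: cylinder_param_def strip_def truncated_cylinder_def vertical_cylinder_def)

end

theory Submission
  imports Defs
begin

text \<open>
In the half-plane model, write \<open>k = \<kappa>\<^sub>g / sqrt (- \<kappa>)\<close> and let \<open>T\<close> be the Euclidean unit tangent of
\<open>\<alpha>\<close>.  Constant geodesic curvature means that \<open>c = (k - Re T) / Im \<alpha>\<close> and \<open>d = Im T - c Re \<alpha>\<close> are
first integrals, so the curve lies on the Euclidean circle or line
\<open>G = c \<bar>p\<bar>\<^sup>2 + 2 d Re p - 2 k Im p + e = 0\<close>.  On it \<open>2 Im \<alpha> T = Q \<alpha>\<close> for the real quadratic polynomial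
\<open>Q z = c z\<^sup>2 + 2 d z + e\<close>, whose discriminant is nonnegative because \<open>k\<^sup>2 \<le> 1\<close>.  This Riccati equation
has a fractional linear solution, which together with completeness shows that \<open>\<alpha>\<close> is a homeomorphism
onto the zero set of \<open>G\<close>; the sets \<open>G > 0\<close> and \<open>G < 0\<close> are connected.  The cylinder therefore
separates the slab into two components.

The cylinder has \<open>\<bar>A\<bar>\<^sup>2 = \<kappa>\<^sub>g\<^sup>2\<close> and \<open>Ric N = \<kappa>\<close>, the slices are totally geodesic and
\<open>cos \<gamma> = 0\<close>, so integration by parts turns the second variation into the Dirichlet integral of \<open>u\<close>
minus \<open>(\<kappa>\<^sub>g\<^sup>2 + \<kappa>) \<integral> u\<^sup>2\<close>, which is nonnegative.
\<close>

section \<open>Smooth maps\<close>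

text \<open>Apart from completeness the hypotheses on the curve are local, whereas
  \<open>strongly_stable\<close> asks for global facts: a parametrisation with continuous inverse
  and exactly two complementary components. Completeness enters only as unboundedness of arc length
  in both directions. A classification into geodesics, equidistant curves and horocycles is avoided:
  all of them are integral curves, up to parametrisation, of one Killing field \<open>Q\<close>, and
  one computation covers them. The bound on \<open>\<kappa>\<^sub>g\<close> serves two unrelated
  purposes: it excludes closed circles, and it gives the zero order term of the Jacobi operator the
  favourable sign. The two choices of \<open>D\<close> are treated together through a sign
  \<open>w\<close> with value 1 or -1, which selects both the component \<open>side w\<close> and
  the normal \<open>N w\<close> pointing into it. Since the parameter of the curve is arbitrary, the
  induced metric keeps a variable coefficient \<open>E\<close>.\<close>

lemma frechet_derivative_cong_open:
  assumes "open V" "x \<in> V" "\<And>y. y \<in> V \<Longrightarrow> f y = g y"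
  shows "frechet_derivative f (at x) = frechet_derivative g (at x)"
proof -
  have "(f has_derivative f') (at x) \<longleftrightarrow> (g has_derivative f') (at x)" for f'
    using has_derivative_transform_within_open[of f f' x UNIV V g]
      has_derivative_transform_within_open[of g f' x UNIV V f] assms by auto
  then show ?thesis
    by (simp add: frechet_derivative_def)
qed

lemma frechet_derivativeI:
  "(f has_derivative f') (at x) \<Longrightarrow> frechet_derivative f (at x) v = f' v"
  using frechet_derivative_at by metis

lemma has_derivative_frechet:
  "f differentiable (at x) \<Longrightarrow> (f has_derivative frechet_derivative f (at x)) (at x)"
  by (simp add: frechet_derivative_works)

lemma smooth_on_open: "smooth_on V f \<Longrightarrow> open V"
  by (simp add: smooth_on_def)

lemma smooth_on_differentiable: "smooth_on V f \<Longrightarrow> x \<in> V \<Longrightarrow> f differentiable (at x)"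
  unfolding smooth_on_def by (drule conjunct2, drule spec[of _ "[]"]) simp

lemma smooth_on_frechet: "smooth_on V f \<Longrightarrow> smooth_on V (\<lambda>x. frechet_derivative f (at x) v)"
  by (simp add: smooth_on_def flip: iter_deriv.simps(2))

lemma smooth_on_continuous_on: "smooth_on V f \<Longrightarrow> continuous_on V f"
  by (simp add: smooth_on_differentiable continuous_at_imp_continuous_on
      differentiable_imp_continuous_within)

text \<open>A class of differentiable maps that is stable under directional derivatives consists of
  smooth maps. Derivatives need to agree with a member of the class only on \<open>V\<close>, since
  nothing controls them elsewhere; the induction over the list of directions therefore runs over all
  maps that agree on \<open>V\<close> with a member.\<close>

lemma smooth_on_coinduct:
  fixes f :: "'a::euclidean_space \<Rightarrow> 'b::real_normed_vector"
  assumes "open V" "P f"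
    and diff: "\<And>f x. P f \<Longrightarrow> x \<in> V \<Longrightarrow> f differentiable (at x)"
    and step: "\<And>f v. P f \<Longrightarrow> \<exists>g. P g \<and> (\<forall>x\<in>V. frechet_derivative f (at x) v = g x)"
  shows "smooth_on V f"
proof -
  have *: "\<exists>g. P g \<and> (\<forall>x\<in>V. iter_deriv vs f x = g x)" if "\<exists>g. P g \<and> (\<forall>x\<in>V. f x = g x)"
    for vs and f :: "'a \<Rightarrow> 'b"
    using that
  proof (induction vs arbitrary: f)
    case (Cons v vs)
    then obtain g where g: "P g" "\<forall>x\<in>V. f x = g x" by blast
    then obtain g' where g': "P g'" "\<forall>x\<in>V. frechet_derivative g (at x) v = g' x"
      using step by blast
    have "\<forall>x\<in>V. frechet_derivative f (at x) v = g' x"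
      using frechet_derivative_cong_open[OF \<open>open V\<close>, of _ f g] g(2) g'(2) by simp
    with g'(1) show ?case using Cons.IH[of "\<lambda>x. frechet_derivative f (at x) v"] by auto
  qed simp
  have "iter_deriv vs f differentiable (at x)" if x: "x \<in> V" for vs x
  proof -
    obtain g where g: "P g" "\<forall>x\<in>V. iter_deriv vs f x = g x" using * \<open>P f\<close> by blast
    have "(g has_derivative frechet_derivative g (at x)) (at x)"
      using diff g(1) x has_derivative_frechet by blast
    then have "(iter_deriv vs f has_derivative frechet_derivative g (at x)) (at x)"
      using has_derivative_transform_within_open[OF _ \<open>open V\<close> x, of g _ UNIV] g(2) by simp
    then show ?thesis by (rule differentiableI)
  qed
  then show ?thesis using \<open>open V\<close> by (simp add: smooth_on_def)
qed

lemma smooth_on_affine: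
  assumes "bounded_linear L" "open V"
  shows "smooth_on V (\<lambda>x. L x + c)"
proof (rule smooth_on_coinduct[where P = "\<lambda>f. \<exists>L c. bounded_linear L \<and> f = (\<lambda>x. L x + c)"])
  show "\<exists>L' c'. bounded_linear L' \<and> (\<lambda>x. L x + c) = (\<lambda>x. L' x + c')" using assms(1) by blast
  fix f :: "'a \<Rightarrow> 'b" assume "\<exists>L c. bounded_linear L \<and> f = (\<lambda>x. L x + c)"
  then obtain L c where L: "bounded_linear L" "f = (\<lambda>x. L x + c)" by blast
  have D: "(f has_derivative L) (at x)" for x
    unfolding L(2) by (intro has_derivative_add_const bounded_linear_imp_has_derivative L)
  then show "f differentiable (at x)" for x by (rule differentiableI)
  \<comment> \<open>The derivative is constant; written as \<open>0 + L v\<close> it is again an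
    affine map, with linear part zero.\<close>
  have "(\<lambda>x. frechet_derivative f (at x) v) = (\<lambda>x. 0 + L v)" for v
    using frechet_derivativeI[OF D] by simp
  then show "\<exists>g. (\<exists>L c. bounded_linear L \<and> g = (\<lambda>x. L x + c))
      \<and> (\<forall>x\<in>V. frechet_derivative f (at x) v = g x)" for v
    by (intro exI[of _ "\<lambda>x. 0 + L v"] conjI exI[of _ "\<lambda>x. 0"] exI[of _ "L v"]) (simp_all add: fun_eq_iff)
qed (rule assms)

lemma smooth_on_const: "open V \<Longrightarrow> smooth_on V (\<lambda>x. c)"
  using smooth_on_affine[OF bounded_linear_zero, of V c] by simp

lemma smooth_on_add:
  assumes "smooth_on V f" "smooth_on V g"
  shows "smooth_on V (\<lambda>x. f x + g x)"
proof (rule smooth_on_coinduct[where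
      P = "\<lambda>h. \<exists>f g. smooth_on V f \<and> smooth_on V g \<and> h = (\<lambda>x. f x + g x)"])
  show "open V" using assms smooth_on_open by blast
  show "\<exists>f' g'. smooth_on V f' \<and> smooth_on V g' \<and> (\<lambda>x. f x + g x) = (\<lambda>x. f' x + g' x)"
    using assms by blast
  fix h :: "'a \<Rightarrow> 'b" assume "\<exists>f g. smooth_on V f \<and> smooth_on V g \<and> h = (\<lambda>x. f x + g x)"
  then obtain f g where fg: "smooth_on V f" "smooth_on V g" "h = (\<lambda>x. f x + g x)" by blast
  have D: "(h has_derivative
      (\<lambda>v. frechet_derivative f (at x) v + frechet_derivative g (at x) v)) (at x)"
    if "x \<in> V" for x
    unfolding fg(3) using fg that
    by (intro has_derivative_add has_derivative_frechet smooth_on_differentiable)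
  then show "h differentiable (at x)" if "x \<in> V" for x
    using that differentiableI by blast
  show "\<exists>k. (\<exists>f g. smooth_on V f \<and> smooth_on V g \<and> k = (\<lambda>x. f x + g x))
      \<and> (\<forall>x\<in>V. frechet_derivative h (at x) v = k x)" for v
  proof (rule exI[of _ "\<lambda>x. frechet_derivative f (at x) v + frechet_derivative g (at x) v"], intro conjI ballI)
    show "\<exists>k l. smooth_on V k \<and> smooth_on V l
        \<and> (\<lambda>x. frechet_derivative f (at x) v + frechet_derivative g (at x) v) = (\<lambda>x. k x + l x)"
      using smooth_on_frechet[OF fg(1)] smooth_on_frechet[OF fg(2)] by blast
  qed (rule frechet_derivativeI[OF D])
qed

inductive prod_sum :: "'a::euclidean_space set \<Rightarrow> ('a \<Rightarrow> 'b::real_normed_algebra) \<Rightarrow> bool"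
  for V where
  "smooth_on V f \<Longrightarrow> smooth_on V g \<Longrightarrow> prod_sum V (\<lambda>x. f x * g x)"
| "prod_sum V f \<Longrightarrow> prod_sum V g \<Longrightarrow> prod_sum V (\<lambda>x. f x + g x)"

text \<open>The Leibniz rule leaves the set of single products, so the coinduction runs over finite
  sums of products.\<close>

lemma smooth_on_mult:
  fixes f g :: "'a::euclidean_space \<Rightarrow> 'b::real_normed_algebra"
  assumes "smooth_on V f" "smooth_on V g"
  shows "smooth_on V (\<lambda>x. f x * g x)"
proof (rule smooth_on_coinduct[where P = "prod_sum V"])
  show "open V" using assms smooth_on_open by blast
  show "prod_sum V (\<lambda>x. f x * g x)" using assms by (rule prod_sum.intros)
  have *: "(\<forall>x\<in>V. h differentiable (at x))
      \<and> (\<forall>v. \<exists>k. prod_sum V k \<and> (\<forall>x\<in>V. frechet_derivative h (at x) v = k x))"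
    if "prod_sum V h" for h :: "'a \<Rightarrow> 'b"
    using that
  proof induction
    case (1 f g)
    have D: "((\<lambda>x. f x * g x) has_derivative
        (\<lambda>v. f x * frechet_derivative g (at x) v + frechet_derivative f (at x) v * g x)) (at x)"
      if "x \<in> V" for x
      using 1 that by (intro has_derivative_mult has_derivative_frechet smooth_on_differentiable)
    have "prod_sum V (\<lambda>x. f x * frechet_derivative g (at x) v + frechet_derivative f (at x) v * g x)"
      for v
      using 1 smooth_on_frechet by (intro prod_sum.intros) auto
    moreover have "\<forall>x\<in>V. frechet_derivative (\<lambda>x. f x * g x) (at x) v
        = f x * frechet_derivative g (at x) v + frechet_derivative f (at x) v * g x" for v
      by (auto intro: frechet_derivativeI[OF D])
    moreover have "\<forall>x\<in>V. (\<lambda>x. f x * g x) differentiable (at x)"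
      using differentiableI[OF D] by blast
    ultimately show ?case by meson
  next
    case (2 f g)
    have D: "((\<lambda>x. f x + g x) has_derivative
        (\<lambda>v. frechet_derivative f (at x) v + frechet_derivative g (at x) v)) (at x)"
      if "x \<in> V" for x
      using 2 that by (intro has_derivative_add has_derivative_frechet) auto
    show ?case
    proof (intro conjI allI)
      fix v
      obtain k l where "prod_sum V k" "\<forall>x\<in>V. frechet_derivative f (at x) v = k x"
        "prod_sum V l" "\<forall>x\<in>V. frechet_derivative g (at x) v = l x"
        using 2 by blast
      then show "\<exists>k. prod_sum V k \<and> (\<forall>x\<in>V. frechet_derivative (\<lambda>x. f x + g x) (at x) v = k x)"
        using frechet_derivativeI[OF D] by (intro exI[of _ "\<lambda>x. k x + l x"]) (auto intro: prod_sum.intros)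
    qed (use differentiableI[OF D] in blast)
  qed
  show "h differentiable (at x)" if "prod_sum V h" "x \<in> V" for h :: "'a \<Rightarrow> 'b" and x
    using * that by blast
  show "\<exists>k. prod_sum V k \<and> (\<forall>x\<in>V. frechet_derivative h (at x) v = k x)"
    if "prod_sum V h" for h :: "'a \<Rightarrow> 'b" and v
    using * that by blast
qed

lemma smooth_on_bounded_linear_comp:
  fixes f :: "'a::euclidean_space \<Rightarrow> 'b::real_normed_vector"
    and L :: "'b \<Rightarrow> 'c::real_normed_vector"
  assumes "bounded_linear L" "smooth_on V f"
  shows "smooth_on V (\<lambda>x. L (f x))"
proof (rule smooth_on_coinduct[where P = "\<lambda>h. \<exists>f. smooth_on V f \<and> h = (\<lambda>x. L (f x))"])
  show "open V" using assms smooth_on_open by blast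
  show "\<exists>g. smooth_on V g \<and> (\<lambda>x. L (f x)) = (\<lambda>x. L (g x))" using assms by blast
  fix h :: "'a \<Rightarrow> 'c" assume "\<exists>f. smooth_on V f \<and> h = (\<lambda>x. L (f x))"
  then obtain f where f: "smooth_on V f" "h = (\<lambda>x. L (f x))" by blast
  have D: "(h has_derivative (\<lambda>v. L (frechet_derivative f (at x) v))) (at x)" if "x \<in> V" for x
    unfolding f(2) using f that
    by (intro bounded_linear.has_derivative[OF assms(1)] has_derivative_frechet
        smooth_on_differentiable)
  then show "h differentiable (at x)" if "x \<in> V" for x
    using that differentiableI by blast
  show "\<exists>k. (\<exists>f. smooth_on V f \<and> k = (\<lambda>x. L (f x)))
      \<and> (\<forall>x\<in>V. frechet_derivative h (at x) v = k x)" for v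
  proof (rule exI[of _ "\<lambda>x. L (frechet_derivative f (at x) v)"], intro conjI ballI)
    show "\<exists>k. smooth_on V k \<and> (\<lambda>x. L (frechet_derivative f (at x) v)) = (\<lambda>x. L (k x))"
      using smooth_on_frechet[OF f(1)] by blast
  qed (rule frechet_derivativeI[OF D])
qed

lemma smooth_on_comp_bounded_linear:
  fixes f :: "'b::euclidean_space \<Rightarrow> 'c::real_normed_vector"
    and L :: "'a::euclidean_space \<Rightarrow> 'b"
  assumes "bounded_linear L" "smooth_on UNIV f"
  shows "smooth_on UNIV (\<lambda>x. f (L x))"
proof (rule smooth_on_coinduct[where P = "\<lambda>h. \<exists>f. smooth_on UNIV f \<and> h = (\<lambda>x. f (L x))"])
  show "\<exists>g. smooth_on UNIV g \<and> (\<lambda>x. f (L x)) = (\<lambda>x. g (L x))" using assms by blast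
  fix h :: "'a \<Rightarrow> 'c" assume "\<exists>f. smooth_on UNIV f \<and> h = (\<lambda>x. f (L x))"
  then obtain f where f: "smooth_on UNIV f" "h = (\<lambda>x. f (L x))" by blast
  have D: "(h has_derivative (\<lambda>v. frechet_derivative f (at (L x)) (L v))) (at x)" for x
    using diff_chain_at[OF bounded_linear_imp_has_derivative[OF assms(1)]
        has_derivative_frechet[OF smooth_on_differentiable[OF f(1)]], of x]
    unfolding f(2) by (simp add: o_def)
  then show "h differentiable (at x)" for x
    using differentiableI by blast
  show "\<exists>k. (\<exists>f. smooth_on UNIV f \<and> k = (\<lambda>x. f (L x)))
      \<and> (\<forall>x\<in>UNIV. frechet_derivative h (at x) v = k x)" for v
  proof (rule exI[of _ "\<lambda>x. frechet_derivative f (at (L x)) (L v)"], intro conjI ballI)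
    show "\<exists>k. smooth_on UNIV k
        \<and> (\<lambda>x. frechet_derivative f (at (L x)) (L v)) = (\<lambda>x. k (L x))"
      using smooth_on_frechet[OF f(1)] by blast
  qed (rule frechet_derivativeI[OF D])
qed simp

section \<open>Curvature of the product metric\<close>

text \<open>\<open>sharp\<close> is a definite description, so nondegeneracy of the metric has to be
  supplied along with the defining equation.\<close>

lemma sharp_eqI:
  assumes "\<And>y. g p x y = \<phi> y" "\<And>z. (\<And>y. g p z y = g p x y) \<Longrightarrow> z = x"
  shows "sharp g p \<phi> = x"
  unfolding sharp_def using assms by (intro the_equality) auto

lemma has_derivative_hyp_metric:
  assumes "Im p \<noteq> 0" "\<kappa> \<noteq> 0"
  shows "((\<lambda>p. hyp_metric \<kappa> p v w) has_derivative
    (\<lambda>x. 2 * (v \<bullet> w) * Im x / (\<kappa> * Im p ^ 3))) (at p)"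
proof -
  have "((\<lambda>y. (v \<bullet> w) / (- \<kappa> * y\<^sup>2)) has_real_derivative
      2 * (v \<bullet> w) / (\<kappa> * Im p ^ 3)) (at (Im p))"
    by (auto intro!: derivative_eq_intros simp: assms)
      (simp add: assms field_simps power2_eq_square power3_eq_cube)
  from diff_chain_at[OF bounded_linear_imp_has_derivative[OF bounded_linear_Im]
      this[unfolded has_field_derivative_def]]
  show ?thesis
    unfolding hyp_metric_def by (simp add: o_def)
qed

text \<open>Multiplied by \<open>- 1 / Im p\<close> this is the Christoffel form of the half-plane
  metric. The curvature \<kappa> is absent because a constant factor in the metric does not change
  its connection.\<close>

definition chr_form :: "complex \<Rightarrow> complex \<Rightarrow> complex" where
  "chr_form v w = Im v *\<^sub>R w + Im w *\<^sub>R v - (v \<bullet> w) *\<^sub>R \<i>"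

lemma hyp_metric_nondegenerate:
  assumes "Im p \<noteq> 0" "\<kappa> \<noteq> 0" "\<And>y. hyp_metric \<kappa> p z y = hyp_metric \<kappa> p x y"
  shows "z = x"
  using assms(3)[of 1] assms(3)[of \<i>] assms(1,2)
  by (simp add: hyp_metric_def inner_complex_def complex_eq_iff)

lemma christoffel_hyp_metric:
  assumes "Im p \<noteq> 0" "\<kappa> \<noteq> 0"
  shows "christoffel (hyp_metric \<kappa>) p v w = - (1 / Im p) *\<^sub>R chr_form v w"
  unfolding christoffel_def
proof (rule sharp_eqI)
  fix y
  show "hyp_metric \<kappa> p (- (1 / Im p) *\<^sub>R chr_form v w) y =
    (frechet_derivative (\<lambda>p'. hyp_metric \<kappa> p' w y) (at p) v +
     frechet_derivative (\<lambda>p'. hyp_metric \<kappa> p' v y) (at p) w -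
     frechet_derivative (\<lambda>p'. hyp_metric \<kappa> p' v w) (at p) y) / 2"
    unfolding frechet_derivativeI[OF has_derivative_hyp_metric[OF assms]]
    using assms
    by (simp add: hyp_metric_def chr_form_def inner_complex_def field_simps
        power2_eq_square power3_eq_cube)
qed (rule hyp_metric_nondegenerate[OF assms])

lemma has_derivative_product_metric:
  assumes "Im (fst p) \<noteq> 0" "\<kappa> \<noteq> 0"
  shows "((\<lambda>p. product_metric \<kappa> p v w) has_derivative
    (\<lambda>x. 2 * (fst v \<bullet> fst w) * Im (fst x) / (\<kappa> * Im (fst p) ^ 3))) (at p)"
  unfolding product_metric_def
  using diff_chain_at[OF bounded_linear_imp_has_derivative[OF bounded_linear_fst]
      has_derivative_hyp_metric[OF assms], of "fst v" "fst w"]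
  by (intro has_derivative_add_const) (simp add: o_def)

lemma product_metric_nondegenerate:
  assumes "Im (fst p) \<noteq> 0" "\<kappa> \<noteq> 0" "\<And>y. product_metric \<kappa> p z y = product_metric \<kappa> p x y"
  shows "z = x"
proof (rule prod_eqI)
  show "fst z = fst x"
    using hyp_metric_nondegenerate[OF assms(1,2)] assms(3)[of "(_, 0)"]
    by (simp add: product_metric_def)
  show "snd z = snd x"
    using assms(3)[of "(0, 1)"] by (simp add: product_metric_def hyp_metric_def)
qed

lemma christoffel_product_metric:
  assumes "Im (fst p) \<noteq> 0" "\<kappa> \<noteq> 0"
  shows "christoffel (product_metric \<kappa>) p v w
    = (- (1 / Im (fst p)) *\<^sub>R chr_form (fst v) (fst w), 0)"
  unfolding christoffel_def
proof (rule sharp_eqI)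
  fix y
  show "product_metric \<kappa> p (- (1 / Im (fst p)) *\<^sub>R chr_form (fst v) (fst w), 0) y =
    (frechet_derivative (\<lambda>p'. product_metric \<kappa> p' w y) (at p) v +
     frechet_derivative (\<lambda>p'. product_metric \<kappa> p' v y) (at p) w -
     frechet_derivative (\<lambda>p'. product_metric \<kappa> p' v w) (at p) y) / 2"
    unfolding frechet_derivativeI[OF has_derivative_product_metric[OF assms]]
    using assms
    by (simp add: product_metric_def hyp_metric_def chr_form_def inner_complex_def field_simps
        power2_eq_square power3_eq_cube)
qed (rule product_metric_nondegenerate[OF assms])

lemma frechet_derivative_christoffel_product_metric:
  assumes "p \<in> product_space" "\<kappa> \<noteq> 0"
  shows "frechet_derivative (\<lambda>p. christoffel (product_metric \<kappa>) p v w) (at p) x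
    = ((Im (fst x) / (Im (fst p))\<^sup>2) *\<^sub>R chr_form (fst v) (fst w), 0)"
proof -
  have op: "open product_space"
    unfolding product_space_def hyp_plane_def by (intro open_Times open_halfspace_Im_gt open_UNIV)
  have y: "Im (fst p) \<noteq> 0" using assms by (auto simp: product_space_def hyp_plane_def)
  have "frechet_derivative (\<lambda>p. christoffel (product_metric \<kappa>) p v w) (at p)
    = frechet_derivative (\<lambda>p. (- (1 / Im (fst p)) *\<^sub>R chr_form (fst v) (fst w), 0)) (at p)"
    by (rule frechet_derivative_cong_open[OF op assms(1)])
      (rule christoffel_product_metric, use assms in \<open>auto simp: product_space_def hyp_plane_def\<close>)
  moreover have "((\<lambda>p::complex \<times> real. (- (1 / Im (fst p)) *\<^sub>R chr_form (fst v) (fst w), 0::real))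
      has_derivative (\<lambda>x. ((Im (fst x) / (Im (fst p))\<^sup>2) *\<^sub>R chr_form (fst v) (fst w), 0))) (at p)"
  proof -
    have "((\<lambda>y. - (1 / y)) has_real_derivative 1 / (Im (fst p))\<^sup>2) (at (Im (fst p)))"
      by (auto intro!: derivative_eq_intros simp: y power2_eq_square)
    from diff_chain_at[OF bounded_linear_imp_has_derivative[OF
          bounded_linear_compose[OF bounded_linear_Im bounded_linear_fst]]
        this[unfolded has_field_derivative_def]]
    have "((\<lambda>p::complex \<times> real. - (1 / Im (fst p))) has_derivative
        (\<lambda>x. Im (fst x) / (Im (fst p))\<^sup>2)) (at p)"
      by (simp add: o_def)
    then show ?thesis
      by (intro has_derivative_Pair has_derivative_scaleR_left has_derivative_const)
  qed
  ultimately show ?thesis by (simp add: frechet_derivativeI)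
qed

lemma trace_of_complex_times_real:
  "trace_of F = Re (fst (F (1, 0))) + Im (fst (F (\<i>, 0))) + snd (F (0, 1))"
  for F :: "complex \<times> real \<Rightarrow> complex \<times> real"
  unfolding trace_of_def Basis_prod_def Basis_complex_def
  by (subst sum.union_disjoint)
    (auto simp: sum.insert_if inner_prod_def inner_complex_def image_iff)

lemma trace_of_real_times_real: "trace_of F = fst (F (1, 0)) + snd (F (0, 1))"
  for F :: "real \<times> real \<Rightarrow> real \<times> real"
  unfolding trace_of_def Basis_prod_def
  by (subst sum.union_disjoint) (auto simp: inner_prod_def)

text \<open>Only the hyperbolic factor contributes: all Christoffel terms have vertical component
  zero, and the horizontal trace is the Ricci form of a plane of curvature \<kappa>.\<close>

lemma Ric_product_metric:
  assumes "p \<in> product_space" "\<kappa> \<noteq> 0"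
  shows "Ric (product_metric \<kappa>) p v = \<kappa> * hyp_metric \<kappa> (fst p) (fst v) (fst v)"
proof -
  have y: "Im (fst p) \<noteq> 0" using assms by (auto simp: product_space_def hyp_plane_def)
  \<comment> \<open>With the reciprocal height as a variable the trace becomes a polynomial
    identity.\<close>
  define r where "r = 1 / Im (fst p)"
  have r: "1 / Im (fst p) = r" "Im x / (Im (fst p))\<^sup>2 = Im x * (r * r)"
    "\<kappa> * hyp_metric \<kappa> (fst p) (fst v) (fst v)
      = - (Re (fst v) * Re (fst v) + Im (fst v) * Im (fst v)) * (r * r)" for x
    using y assms(2) by (simp_all add: r_def hyp_metric_def inner_complex_def power2_eq_square minus_divide_left)
  show ?thesis
    unfolding Ric_def trace_of_complex_times_real riemann_def
      frechet_derivative_christoffel_product_metric[OF assms]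
      christoffel_product_metric[OF y assms(2)] r
    by (simp add: chr_form_def inner_complex_def) (simp add: algebra_simps)
qed

section \<open>Metrics of the form \<open>E(s) ds\<^sup>2 + dt\<^sup>2\<close>\<close>

text \<open>The form taken by the metric induced on a vertical cylinder whose base curve has an
  arbitrary parameter; \<open>E\<close> is the squared speed.\<close>

definition strip_metric :: "(real \<Rightarrow> real) \<Rightarrow> (real \<times> real) riem" where
  "strip_metric E q v w = E (fst q) * fst v * fst w + snd v * snd w"

lemma sharp_strip_metric:
  assumes "E (fst q) \<noteq> 0" "linear \<phi>"
  shows "sharp (strip_metric E) q \<phi> = (\<phi> (1, 0) / E (fst q), \<phi> (0, 1))"
proof (rule sharp_eqI)
  fix y :: "real \<times> real"
  have "\<phi> y = \<phi> (fst y *\<^sub>R (1, 0) + snd y *\<^sub>R (0, 1))" by simp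
  also have "\<dots> = fst y * \<phi> (1, 0) + snd y * \<phi> (0, 1)"
    unfolding linear_add[OF assms(2)] linear_cmul[OF assms(2)] by simp
  finally show "strip_metric E q (\<phi> (1, 0) / E (fst q), \<phi> (0, 1)) y = \<phi> y"
    using assms(1) by (simp add: strip_metric_def mult.commute)
next
  fix z assume *: "\<And>y. strip_metric E q z y
    = strip_metric E q (\<phi> (1, 0) / E (fst q), \<phi> (0, 1)) y"
  show "z = (\<phi> (1, 0) / E (fst q), \<phi> (0, 1))"
    using *[of "(1, 0)"] *[of "(0, 1)"] assms(1) by (cases z) (simp add: strip_metric_def nonzero_eq_divide_eq mult.commute)
qed

lemma christoffel_strip_metric:
  assumes "E (fst q) \<noteq> 0" "(E has_real_derivative E') (at (fst q))"
  shows "christoffel (strip_metric E) q v w = (E' / (2 * E (fst q)) * fst v * fst w, 0)"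
proof -
  have D: "((\<lambda>q. strip_metric E q v w) has_derivative (\<lambda>x. E' * fst x * fst v * fst w)) (at q)"
    for v w
  proof -
    have "((\<lambda>q. E (fst q)) has_derivative (\<lambda>x. E' * fst x)) (at q)"
      using diff_chain_at[OF bounded_linear_imp_has_derivative[OF bounded_linear_fst]
          assms(2)[unfolded has_field_derivative_def]] by (simp add: o_def)
    then show ?thesis
      unfolding strip_metric_def
      by (intro has_derivative_add_const has_derivative_mult_left)
  qed
  have "linear (\<lambda>x. (E' * fst v * fst w * fst x + E' * fst w * fst v * fst x
      - E' * fst x * fst v * fst w) / 2)"
    by (simp add: linear_iff field_simps)
  from sharp_strip_metric[of E q, OF assms(1) this] show ?thesis
    unfolding christoffel_def frechet_derivativeI[OF D] by simp
qed

section \<open>Curves of constant geodesic curvature\<close>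

lemma antiderivative_UNIV:
  fixes f :: "real \<Rightarrow> real"
  assumes "continuous_on UNIV f"
  obtains F where "\<And>x. (F has_real_derivative f x) (at x)"
proof -
  have int: "f integrable_on {a..b}" for a b
    by (meson assms continuous_on_subset integrable_continuous_real subset_UNIV)
  \<comment> \<open>The starting point \<open>- (\<bar>s\<bar> + 1)\<close> lies to the left of both
    \<open>0\<close> and \<open>s\<close>, so no integral with reversed limits occurs; the next fact
    shows that any starting point further left gives the same value.\<close>
  define F where "F s = integral {- (\<bar>s\<bar> + 1)..s} f - integral {- (\<bar>s\<bar> + 1)..0} f" for s
  have F: "F s = integral {- R..s} f - integral {- R..0} f" if "\<bar>s\<bar> < R" for s R
  proof -
    have "integral {-x..s} f - integral {-x..0} f = integral {-y..s} f - integral {-y..0} f"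
      if "\<bar>s\<bar> \<le> x" "x \<le> y" for x y
    proof -
      have "integral {-y..-x} f + integral {-x..s} f = integral {-y..s} f"
        "integral {-y..-x} f + integral {-x..0} f = integral {-y..0} f"
        using that by (auto intro!: Henstock_Kurzweil_Integration.integral_combine int)
      then show ?thesis by linarith
    qed
    from this[of "\<bar>s\<bar> + 1" R] this[of R "\<bar>s\<bar> + 1"] that show ?thesis
      unfolding F_def by linarith
  qed
  show ?thesis
  proof
    fix x :: real
    define R where "R = \<bar>x\<bar> + 1"
    have "((\<lambda>u. integral {- R..u} f) has_real_derivative f x) (at x within {-R..R})"
      using assms by (intro integral_has_real_derivative continuous_on_subset[OF assms])
        (auto simp: R_def)
    then have "((\<lambda>u. integral {- R..u} f) has_real_derivative f x) (at x)"
      by (subst (asm) at_within_interior) (auto simp: R_def)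
    then have "((\<lambda>u. integral {- R..u} f - integral {- R..0} f) has_real_derivative f x) (at x)"
      by (auto intro!: derivative_eq_intros)
    then show "(F has_real_derivative f x) (at x)"
      by (rule has_field_derivative_transform_within_open[of _ _ _ "{-R<..<R}"])
        (auto simp: R_def F[of _ R, unfolded R_def])
  qed
qed

lemma metric_space_strict_mono:
  fixes F :: "real \<Rightarrow> real"
  assumes "strict_mono F"
  shows "Metric_space UNIV (\<lambda>s t. \<bar>F s - F t\<bar>)"
  using assms by unfold_locales (auto simp: strict_mono_eq abs_minus_commute)

text \<open>If \<open>F\<close> were bounded above, the values \<open>F n\<close> at the natural
  numbers would form a Cauchy sequence, so by completeness the parameters \<open>n\<close> would
  converge to some \<open>t\<close>. But eventually \<open>n\<close> exceeds \<open>t + 1\<close>,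
  which keeps \<open>F n\<close> away from \<open>F t\<close> by monotonicity.\<close>

lemma complete_imp_unbounded:
  fixes F :: "real \<Rightarrow> real"
  assumes "strict_mono F" "Metric_space.mcomplete UNIV (\<lambda>s t. \<bar>F s - F t\<bar>)"
  shows "\<exists>s\<ge>0. F s > b"
proof (rule ccontr)
  interpret M: Metric_space UNIV "\<lambda>s t. \<bar>F s - F t\<bar>"
    using assms(1) by (rule metric_space_strict_mono)
  assume "\<not> (\<exists>s\<ge>0. F s > b)"
  then have b: "F (real n) \<le> b" for n by (meson not_le of_nat_0_le_iff)
  have "incseq (\<lambda>n. F (real n))"
    using assms(1) by (auto simp: incseq_def strict_mono_less_eq)
  then have "convergent (\<lambda>n. F (real n))"
    using b by (metis incseq_convergent convergentI)
  then have "Cauchy (\<lambda>n. F (real n))" by (rule convergent_Cauchy)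
  then have "M.MCauchy real"
    unfolding M.MCauchy_def by (auto simp: Cauchy_def dist_real_def)
  then obtain t where t: "limitin M.mtopology real t sequentially"
    using assms(2) unfolding M.mcomplete_def by blast
  have "F t < F (t + 1)" using assms(1) by (simp add: strict_mono_less)
  then have "\<forall>\<^sub>F n in sequentially. \<bar>F (real n) - F t\<bar> < F (t + 1) - F t"
    using t unfolding M.limitin_metric by auto
  moreover have "\<forall>\<^sub>F n in sequentially. t + 1 \<le> real n"
    using filterlim_real_sequentially unfolding filterlim_at_top by blast
  ultimately have "\<forall>\<^sub>F n in sequentially. False"
  proof eventually_elim
    case (elim n)
    then have "F (t + 1) \<le> F (real n)" using assms(1) by (simp add: strict_mono_less_eq)
    with elim show False by linarith
  qed
  then show False by simp
qed

text \<open>A comparison argument in place of the explicit solution by a hyperbolic tangent, so that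
  \<open>b = 0\<close> is included. While \<open>f\<close> stays below \<open>t\<close>, its growth
  is at least a fixed multiple of that of the unbounded function \<open>F\<close>.\<close>

lemma logistic_ivt:
  fixes f \<rho> F :: "real \<Rightarrow> real"
  assumes f: "\<And>s. (f has_real_derivative \<rho> s * (1 - b * (f s)\<^sup>2)) (at s)"
    and F: "\<And>s. (F has_real_derivative \<rho> s) (at s)"
    and pos: "\<And>s. 0 < \<rho> s" "\<And>s. b * (f s)\<^sup>2 < 1" and "f 0 = 0" "0 \<le> b"
    and unb: "\<And>x. \<exists>s\<ge>0. F s > x"
    and t: "0 \<le> t" "b * t\<^sup>2 < 1"
  obtains s where "f s = t"
proof -
  have mono: "f x \<le> f y" if "x \<le> y" for x y
    by (rule DERIV_nonneg_imp_nondecreasing[OF that]) (use f pos in \<open>auto intro!: exI mult_nonneg_nonneg simp: less_imp_le\<close>)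
  have "\<exists>s\<ge>0. t \<le> f s"
  proof (rule ccontr)
    assume "\<not> (\<exists>s\<ge>0. t \<le> f s)"
    then have less: "f s < t" if "0 \<le> s" for s using that by force
    \<comment> \<open>The lower bound for the factor \<open>1 - b * (f s)\<^sup>2\<close> as long as
      \<open>0 \<le> f s < t\<close>; it makes \<open>f - \<delta> F\<close> nondecreasing.\<close>
    define \<delta> where "\<delta> = 1 - b * t\<^sup>2"
    have "0 < \<delta>" using t by (simp add: \<delta>_def)
    have *: "f 0 - \<delta> * F 0 \<le> f s - \<delta> * F s" if "0 \<le> s" for s
    proof (rule DERIV_nonneg_imp_nondecreasing[OF that], intro exI conjI)
      fix x assume x: "0 \<le> x" "x \<le> s"
      show "((\<lambda>s. f s - \<delta> * F s) has_real_derivative \<rho> x * (1 - b * (f x)\<^sup>2) - \<delta> * \<rho> x) (at x)"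
        by (intro DERIV_diff f DERIV_cmult F)
      have "(f x)\<^sup>2 \<le> t\<^sup>2"
        using less[OF x(1)] mono[OF x(1)] \<open>f 0 = 0\<close> by (intro power_mono) auto
      then have "\<delta> \<le> 1 - b * (f x)\<^sup>2"
        using \<open>0 \<le> b\<close> by (simp add: \<delta>_def mult_left_mono)
      then have "\<rho> x * \<delta> \<le> \<rho> x * (1 - b * (f x)\<^sup>2)"
        using pos(1) by (intro mult_left_mono) (auto simp: less_imp_le)
      then show "0 \<le> \<rho> x * (1 - b * (f x)\<^sup>2) - \<delta> * \<rho> x" by (simp add: mult.commute)
    qed
    obtain s where s: "s \<ge> 0" "F s > F 0 + t / \<delta>" using unb by blast
    then have "t < \<delta> * (F s - F 0)" using \<open>0 < \<delta>\<close> by (simp add: field_simps)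
    with *[OF s(1)] less[OF s(1)] \<open>f 0 = 0\<close> show False by (simp add: algebra_simps)
  qed
  then obtain s where "s \<ge> 0" "t \<le> f s" by blast
  then have "\<exists>x. 0 \<le> x \<and> x \<le> s \<and> f x = t"
    using t \<open>f 0 = 0\<close> DERIV_isCont[OF f] by (intro IVT) auto
  with that show ?thesis by blast
qed

locale cgc_curve =
  fixes \<kappa> \<kappa>\<^sub>g :: real and \<alpha> :: "real \<Rightarrow> complex"
  assumes neg: "\<kappa> < 0"
    and regular: "regular_curve \<alpha>"
    and complete: "complete_curve \<kappa> \<alpha>"
    and curvature: "\<And>s. geodesic_curvature \<kappa> \<alpha> s = \<kappa>\<^sub>g"
    and bound: "\<kappa>\<^sub>g\<^sup>2 + \<kappa> \<le> 0"
begin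

definition a :: real where "a = sqrt (- \<kappa>)"
text \<open>The geodesic curvature for the metric rescaled to curvature -1. In absolute value it is
  below 1 for geodesics and equidistant curves and equal to 1 for horocycles.\<close>

definition k :: real where "k = \<kappa>\<^sub>g / a"
definition \<alpha>' :: "real \<Rightarrow> complex" where "\<alpha>' s = vector_derivative \<alpha> (at s)"
definition \<alpha>'' :: "real \<Rightarrow> complex" where "\<alpha>'' s = vector_derivative \<alpha>' (at s)"

lemma a_pos: "0 < a" and a_sq: "a\<^sup>2 = - \<kappa>"
  using neg by (simp_all add: a_def)

lemma k_sq_le: "k\<^sup>2 \<le> 1"
proof -
  have "\<kappa>\<^sub>g\<^sup>2 \<le> a\<^sup>2" using bound a_sq by linarith
  then show ?thesis using a_pos by (simp add: k_def power_divide)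
qed

lemma smooth: "smooth_on UNIV \<alpha>" and Im_pos: "0 < Im (\<alpha> s)" and \<alpha>'_nz: "\<alpha>' s \<noteq> 0"
  using regular by (auto simp: regular_curve_def hyp_plane_def \<alpha>'_def)

lemma frechet_\<alpha>: "frechet_derivative \<alpha> (at s) v = v *\<^sub>R \<alpha>' s"
  using frechet_derivative_eq_vector_derivative[OF smooth_on_differentiable[OF smooth UNIV_I]]
  by (simp add: \<alpha>'_def)

lemma has_vector_derivative_\<alpha>: "(\<alpha> has_vector_derivative \<alpha>' s) (at s)"
  unfolding \<alpha>'_def by (meson UNIV_I smooth smooth_on_differentiable vector_derivative_works)

lemma smooth_\<alpha>': "smooth_on UNIV \<alpha>'"
  using smooth_on_frechet[OF smooth, of 1] by (simp add: frechet_\<alpha>)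

lemma has_vector_derivative_\<alpha>': "(\<alpha>' has_vector_derivative \<alpha>'' s) (at s)"
  unfolding \<alpha>''_def by (meson UNIV_I smooth_\<alpha>' smooth_on_differentiable vector_derivative_works)

lemma frechet_\<alpha>': "frechet_derivative \<alpha>' (at s) v = v *\<^sub>R \<alpha>'' s"
  using frechet_derivative_eq_vector_derivative[OF smooth_on_differentiable[OF smooth_\<alpha>' UNIV_I]]
  by (simp add: \<alpha>''_def)

lemma DERIV_Re:
    "((\<lambda>s. Re (\<alpha> s)) has_real_derivative Re (\<alpha>' s)) (at s)"
    "((\<lambda>s. Re (\<alpha>' s)) has_real_derivative Re (\<alpha>'' s)) (at s)"
  and DERIV_Im:
    "((\<lambda>s. Im (\<alpha> s)) has_real_derivative Im (\<alpha>' s)) (at s)"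
    "((\<lambda>s. Im (\<alpha>' s)) has_real_derivative Im (\<alpha>'' s)) (at s)"
  using has_vector_derivative_\<alpha>[of s] has_vector_derivative_\<alpha>'[of s]
  by (auto simp: has_vector_derivative_complex_iff)

definition r :: "real \<Rightarrow> real" where "r s = norm (\<alpha>' s)"

lemma r_pos: "0 < r s" and r_sq: "(r s)\<^sup>2 = (Re (\<alpha>' s))\<^sup>2 + (Im (\<alpha>' s))\<^sup>2"
  using \<alpha>'_nz by (simp_all add: r_def cmod_power2)

lemma speed_eq: "speed \<kappa> \<alpha> s = r s / (a * Im (\<alpha> s))"
proof -
  have "(r s)\<^sup>2 / (a * Im (\<alpha> s))\<^sup>2 = hyp_metric \<kappa> (\<alpha> s) (\<alpha>' s) (\<alpha>' s)"
    by (simp add: hyp_metric_def r_def power_mult_distrib a_sq power2_norm_eq_inner)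
  then show ?thesis
    using r_pos[of s] a_pos Im_pos[of s]
    by (simp add: speed_def \<alpha>'_def[symmetric] real_sqrt_unique flip: power_divide)
qed

definition J :: "real \<Rightarrow> real" where "J s = Re (\<alpha>' s) * Im (\<alpha>'' s) - Re (\<alpha>'' s) * Im (\<alpha>' s)"

text \<open>The conformal change formula for curvature, multiplied by \<open>r s ^ 3\<close>: the
  normalised hyperbolic curvature is height times Euclidean curvature \<open>J / r\<^sup>3\<close>
  plus the cosine \<open>Re \<alpha>' / r\<close> of the tangent angle.\<close>

lemma curvature_eq: "k * r s ^ 3 = Im (\<alpha> s) * J s + Re (\<alpha>' s) * (r s)\<^sup>2"
proof -
  have y: "Im (\<alpha> s) \<noteq> 0" "a \<noteq> 0" "r s \<noteq> 0" using Im_pos[of s] a_pos r_pos[of s] by auto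
  have "\<kappa>\<^sub>g = hyp_metric \<kappa> (\<alpha> s) (\<alpha>'' s - (1 / Im (\<alpha> s)) *\<^sub>R chr_form (\<alpha>' s) (\<alpha>' s)) (\<i> * \<alpha>' s)
      / speed \<kappa> \<alpha> s ^ 3"
    using curvature[of s] christoffel_hyp_metric[of "\<alpha> s" \<kappa>] y(1) neg
    by (simp add: geodesic_curvature_def covd_def Let_def frechet_\<alpha> frechet_\<alpha>' flip: \<alpha>'_def[abs_def])
  also have "hyp_metric \<kappa> (\<alpha> s) (\<alpha>'' s - (1 / Im (\<alpha> s)) *\<^sub>R chr_form (\<alpha>' s) (\<alpha>' s)) (\<i> * \<alpha>' s)
      = (J s + Re (\<alpha>' s) * (r s)\<^sup>2 / Im (\<alpha> s)) / (a\<^sup>2 * (Im (\<alpha> s))\<^sup>2)"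
    using y(1) unfolding a_sq r_sq
    by (simp add: hyp_metric_def chr_form_def inner_complex_def J_def)
      (simp add: field_simps power2_eq_square)
  also have "\<dots> = (Im (\<alpha> s) * J s + Re (\<alpha>' s) * (r s)\<^sup>2) / (a\<^sup>2 * (Im (\<alpha> s)) ^ 3)"
    using y by (simp add: field_simps power2_eq_square power3_eq_cube)
  also have "\<dots> / speed \<kappa> \<alpha> s ^ 3 = a * (Im (\<alpha> s) * J s + Re (\<alpha>' s) * (r s)\<^sup>2) / r s ^ 3"
    using y unfolding speed_eq by (simp add: power_divide power_mult_distrib)
      (simp add: divide_simps power2_eq_square power3_eq_cube)
  finally show ?thesis
    using y unfolding k_def by simp
qed

text \<open>The conformal change formula solved for the signed Euclidean curvature of \<alpha>, as
  \<open>J_eq\<close> confirms.\<close>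

definition curv :: "real \<Rightarrow> real" where "curv s = (k - Re (\<alpha>' s) / r s) / Im (\<alpha> s)"

lemma J_eq: "J s = curv s * r s ^ 3"
  using curvature_eq[of s] Im_pos[of s] r_pos[of s]
  by (simp add: curv_def field_simps power2_eq_square power3_eq_cube)

lemma DERIV_r: "(r has_real_derivative (Re (\<alpha>' s) * Re (\<alpha>'' s) + Im (\<alpha>' s) * Im (\<alpha>'' s)) / r s) (at s)"
proof -
  have pos: "0 < (Re (\<alpha>' s))\<^sup>2 + (Im (\<alpha>' s))\<^sup>2" using r_pos[of s] by (simp flip: r_sq)
  have "((\<lambda>s. (Re (\<alpha>' s))\<^sup>2 + (Im (\<alpha>' s))\<^sup>2) has_real_derivative
      2 * (Re (\<alpha>' s) * Re (\<alpha>'' s) + Im (\<alpha>' s) * Im (\<alpha>'' s))) (at s)"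
    using DERIV_add[OF DERIV_power[OF DERIV_Re(2)[of s], of 2]
        DERIV_power[OF DERIV_Im(2)[of s], of 2]]
    by (simp add: algebra_simps)
  from DERIV_chain2[where f = sqrt and x = s
      and g = "\<lambda>s. (Re (\<alpha>' s))\<^sup>2 + (Im (\<alpha>' s))\<^sup>2", OF DERIV_real_sqrt[OF pos] this]
  have "(r has_real_derivative inverse (r s) / 2
      * (2 * (Re (\<alpha>' s) * Re (\<alpha>'' s) + Im (\<alpha>' s) * Im (\<alpha>'' s)))) (at s)"
    unfolding r_def[abs_def] cmod_def .
  then show ?thesis by (rule DERIV_cong) (use r_pos[of s] in \<open>simp add: field_simps\<close>)
qed

text \<open>For a tangent angle \<theta> the derivative of \<theta> is Euclidean curvature times
  Euclidean speed; these are the resulting derivatives of its cosine and sine, obtained without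
  choosing an angle function.\<close>

lemma DERIV_cos: "((\<lambda>s. Re (\<alpha>' s) / r s) has_real_derivative - curv s * Im (\<alpha>' s)) (at s)"
  and DERIV_sin: "((\<lambda>s. Im (\<alpha>' s) / r s) has_real_derivative curv s * Re (\<alpha>' s)) (at s)"
proof -
  have r: "r s \<noteq> 0" using r_pos[of s] by simp
  have *: "(x2 * R - x1 * ((x1 * x2 + y1 * y2) / R)) / (R * R) = - (j / R ^ 3) * y1"
    if "R\<^sup>2 = x1\<^sup>2 + y1\<^sup>2" "j = x1 * y2 - x2 * y1" "R \<noteq> 0" for R x1 x2 y1 y2 j :: real
  proof -
    have "(x2 * R - x1 * ((x1 * x2 + y1 * y2) / R)) / (R * R)
        = (x2 * R\<^sup>2 - x1 * (x1 * x2 + y1 * y2)) / R ^ 3"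
      using that(3) by (simp add: field_simps power2_eq_square power3_eq_cube)
    also have "x2 * R\<^sup>2 - x1 * (x1 * x2 + y1 * y2) = - j * y1"
      unfolding that(1,2) by algebra
    finally show ?thesis by simp
  qed
  have c: "curv s = J s / r s ^ 3" using J_eq[of s] r by simp
  show "((\<lambda>s. Re (\<alpha>' s) / r s) has_real_derivative - curv s * Im (\<alpha>' s)) (at s)"
    using DERIV_divide[OF DERIV_Re(2)[of s] DERIV_r r] *[OF r_sq J_def r] by (simp add: c)
  show "((\<lambda>s. Im (\<alpha>' s) / r s) has_real_derivative curv s * Re (\<alpha>' s)) (at s)"
  proof (rule DERIV_cong[OF DERIV_divide[OF DERIV_Im(2)[of s] DERIV_r r]])
    show "(Im (\<alpha>'' s) * r s
        - Im (\<alpha>' s) * ((Re (\<alpha>' s) * Re (\<alpha>'' s) + Im (\<alpha>' s) * Im (\<alpha>'' s)) / r s)) / (r s * r s)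
      = curv s * Re (\<alpha>' s)"
      \<comment> \<open>The same identity with real and imaginary parts exchanged, which reverses
        the sign of the determinant \<open>J\<close>.\<close>
      using *[where ?R = "r s" and ?x1.0 = "Im (\<alpha>' s)" and ?x2.0 = "Im (\<alpha>'' s)"
          and ?y1.0 = "Re (\<alpha>' s)" and ?y2.0 = "Re (\<alpha>'' s)" and ?j = "- J s"] r r_sq[of s]
      by (simp add: c J_def add.commute) (simp add: minus_divide_left left_diff_distrib)
  qed
qed

section \<open>First integrals and the Euclidean circle or line containing the curve\<close>

definition c :: real where "c = curv 0"
definition d :: real where "d = Im (\<alpha>' 0) / r 0 - c * Re (\<alpha> 0)"
definition e :: real where
  "e = - (c * ((Re (\<alpha> 0))\<^sup>2 + (Im (\<alpha> 0))\<^sup>2) + 2 * d * Re (\<alpha> 0) - 2 * k * Im (\<alpha> 0))"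

text \<open>Both sides of \<open>curv s * Im (\<alpha> s) = k - Re (\<alpha>' s) / r s\<close> are
  differentiated: the derivative on the right is \<open>curv s * Im (\<alpha>' s)\<close>, which the
  product rule on the left already contains, so the derivative of \<open>curv\<close> is
  zero.\<close>

lemma curv_const: "curv s = c"
proof -
  have "(curv has_real_derivative 0) (at s)" for s
  proof -
    have "(curv has_real_derivative
        ((0 - (- curv s * Im (\<alpha>' s))) * Im (\<alpha> s) - (k - Re (\<alpha>' s) / r s) * Im (\<alpha>' s))
        / (Im (\<alpha> s) * Im (\<alpha> s))) (at s)"
      unfolding curv_def[abs_def]
      by (intro DERIV_divide DERIV_diff DERIV_const DERIV_cos[unfolded curv_def] DERIV_Im)
        (use Im_pos[of s] in simp)
    moreover have "k - Re (\<alpha>' s) / r s = curv s * Im (\<alpha> s)"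
      using Im_pos[of s] by (simp add: curv_def)
    ultimately show ?thesis by simp
  qed
  then show ?thesis unfolding c_def using DERIV_isconst_all by blast
qed

lemma Re_\<alpha>': "Re (\<alpha>' s) = r s * (k - c * Im (\<alpha> s))"
  using Im_pos[of s] r_pos[of s] curv_const[of s] by (simp add: curv_def field_simps)

lemma Im_\<alpha>': "Im (\<alpha>' s) = r s * (d + c * Re (\<alpha> s))"
proof -
  have "((\<lambda>s. Im (\<alpha>' s) / r s - c * Re (\<alpha> s)) has_real_derivative 0) (at s)" for s
    using DERIV_diff[OF DERIV_sin[of s] DERIV_cmult[OF DERIV_Re(1)[of s], of c]]
    by (simp add: curv_const)
  from DERIV_isconst_all[OF allI[OF this], of s 0] show ?thesis
    using r_pos[of s] by (simp add: d_def field_simps)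
qed

text \<open>For \<open>c \<noteq> 0\<close> the zero set is the Euclidean circle of radius
  \<open>1 / \<bar>c\<bar>\<close> about \<open>(- d / c, k / c)\<close>, by \<open>ce\<close>; for
  \<open>c = 0\<close> it is a line. The constant \<open>e\<close> is fixed by the point
  \<open>\<alpha> 0\<close>.\<close>

definition G :: "complex \<Rightarrow> real" where
  "G p = c * ((Re p)\<^sup>2 + (Im p)\<^sup>2) + 2 * d * Re p - 2 * k * Im p + e"

lemma G_\<alpha>: "G (\<alpha> s) = 0"
proof -
  have "((\<lambda>s. G (\<alpha> s)) has_real_derivative
      c * (2 * Re (\<alpha> s) * Re (\<alpha>' s) + 2 * Im (\<alpha> s) * Im (\<alpha>' s))
      + 2 * d * Re (\<alpha>' s) - 2 * k * Im (\<alpha>' s)) (at s)" for s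
    unfolding G_def
    by (rule DERIV_cong[OF DERIV_add[OF DERIV_diff[OF DERIV_add[OF
            DERIV_cmult[OF DERIV_add[OF DERIV_power[OF DERIV_Re(1)] DERIV_power[OF DERIV_Im(1)]]]
            DERIV_cmult[OF DERIV_Re(1)]] DERIV_cmult[OF DERIV_Im(1)]] DERIV_const]])
      (simp add: algebra_simps)
  moreover have "c * (2 * Re (\<alpha> s) * Re (\<alpha>' s) + 2 * Im (\<alpha> s) * Im (\<alpha>' s))
      + 2 * d * Re (\<alpha>' s) - 2 * k * Im (\<alpha>' s) = 0" for s
    unfolding Re_\<alpha>' Im_\<alpha>' by algebra
  ultimately have "((\<lambda>s. G (\<alpha> s)) has_real_derivative 0) (at s)" for s by simp
  from DERIV_isconst_all[OF allI[OF this], of s 0] show ?thesis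
    by (simp add: G_def e_def)
qed

lemma unit_tangent: "(k - c * Im (\<alpha> s))\<^sup>2 + (d + c * Re (\<alpha> s))\<^sup>2 = 1"
proof -
  have "(r s)\<^sup>2 * ((k - c * Im (\<alpha> s))\<^sup>2 + (d + c * Re (\<alpha> s))\<^sup>2) = (r s)\<^sup>2 * 1"
    using r_sq[of s] unfolding Re_\<alpha>' Im_\<alpha>' by algebra
  then show ?thesis using r_pos[of s] by simp
qed

lemma ce: "c * e = k\<^sup>2 + d\<^sup>2 - 1"
  using unit_tangent[of 0] G_\<alpha>[of 0] unfolding G_def by algebra

text \<open>Quadratic polynomials with real coefficients are exactly the Killing fields of the
  half-plane.\<close>

definition Q :: "complex \<Rightarrow> complex" where "Q z = of_real c * z\<^sup>2 + 2 * of_real d * z + of_real e"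

text \<open>For every \<open>z\<close> the imaginary parts agree, and the real part of
  \<open>Q z\<close> is \<open>G z + 2 * Im z * (k - c * Im z)\<close>.\<close>

lemma Q_eq: "G z = 0 \<Longrightarrow> Q z = 2 * Im z * Complex (k - c * Im z) (d + c * Re z)"
  unfolding G_def Q_def complex_eq_iff
  by (simp add: power2_eq_square algebra_simps)

lemma \<alpha>'_eq: "\<alpha>' s = (r s / (2 * Im (\<alpha> s))) * Q (\<alpha> s)"
  unfolding Q_eq[OF G_\<alpha>] using Im_pos[of s]
  by (simp add: complex_eq_iff Re_\<alpha>' Im_\<alpha>')

text \<open>By \<open>m2_eq\<close> this is a quarter of the discriminant of \<open>Q\<close>. It
  vanishes exactly for horocycles.\<close>

definition m2 :: real where "m2 = 1 - k\<^sup>2"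

lemma m2_nonneg: "0 \<le> m2" and m2_eq: "m2 = d\<^sup>2 - c * e"
  using k_sq_le ce by (simp_all add: m2_def)

definition Z :: "complex set" where "Z = {p. 0 < Im p \<and> G p = 0}"

lemma \<alpha>_in_Z: "\<alpha> s \<in> Z"
  by (simp add: Z_def Im_pos G_\<alpha>)

text \<open>The polarisation of the quadratic form \<open>Q\<close>, with one argument fixed.  The curve is an orbit of
  the one-parameter group of isometries generated by the vector field \<open>Q\<close>, and \<open>\<tau>\<close> is, up to a
  constant, the hyperbolic tangent of the group parameter.\<close>

definition B :: "complex \<Rightarrow> complex" where
  "B z = of_real c * z * \<alpha> 0 + of_real d * (z + \<alpha> 0) + of_real e"

definition \<tau> :: "complex \<Rightarrow> real" where "\<tau> z = Re ((z - \<alpha> 0) / B z)"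

text \<open>The identity between a binary quadratic form, its polarisation and its discriminant. It
  is what makes the derivative of \<tau> along the curve a function of \<tau>.\<close>

lemma B_Q: "(B z)\<^sup>2 - of_real m2 * (z - \<alpha> 0)\<^sup>2 = Q z * Q (\<alpha> 0)"
  unfolding B_def Q_def m2_eq by (simp add: power2_eq_square algebra_simps)

text \<open>A counterpart of \<open>B_Q\<close> with absolute values, available because
  \<open>G\<close> vanishes at both points: each real number
  \<open>c * \<bar>z\<bar>\<^sup>2 + 2 * d * Re z + e\<close> may be replaced by
  \<open>2 * k * Im z\<close>. The positive first summand yields both \<open>B z \<noteq> 0\<close>
  and the strict bound on \<tau>.\<close>

lemma norm_B:
  assumes "z \<in> Z"
  shows "(norm (B z))\<^sup>2 = 4 * Im z * Im (\<alpha> 0) + m2 * (norm (z - \<alpha> 0))\<^sup>2"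
proof -
  define x y p q where "x = Re z" "y = Im z" "p = Re (\<alpha> 0)" "q = Im (\<alpha> 0)"
  note xy = this
  have g: "c * (x\<^sup>2 + y\<^sup>2) + 2 * d * x + e = 2 * k * y" "c * (p\<^sup>2 + q\<^sup>2) + 2 * d * p + e = 2 * k * q"
    using assms G_\<alpha>[of 0] by (simp_all add: Z_def G_def xy)
  have "(norm (B z))\<^sup>2 - (d\<^sup>2 - c * e) * (norm (z - \<alpha> 0))\<^sup>2
    = (c * (x\<^sup>2 + y\<^sup>2) + 2 * d * x + e) * (c * (p\<^sup>2 + q\<^sup>2) + 2 * d * p + e) + 4 * (d\<^sup>2 - c * e) * y * q"
    unfolding cmod_power2 B_def
    by (simp add: xy[symmetric] power2_eq_square algebra_simps)
  then show ?thesis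
    unfolding g m2_eq[symmetric] by (simp add: m2_def xy algebra_simps power2_eq_square)
qed

lemma B_nz: "z \<in> Z \<Longrightarrow> B z \<noteq> 0"
proof
  assume z: "z \<in> Z" "B z = 0"
  have "0 < 4 * Im z * Im (\<alpha> 0) + m2 * (norm (z - \<alpha> 0))\<^sup>2"
    using z(1) Im_pos[of 0] m2_nonneg by (auto simp: Z_def intro!: add_pos_nonneg)
  with norm_B[OF z(1)] z(2) show False by simp
qed

text \<open>The quotient is real on \<open>Z\<close>: after the substitution from
  \<open>G = 0\<close> the two terms of the imaginary part of
  \<open>(z - \<alpha> 0) * cnj (B z)\<close> are both \<open>2 * k * y * q\<close>.\<close>

lemma \<tau>_eq:
  assumes "z \<in> Z"
  shows "(z - \<alpha> 0) / B z = of_real (\<tau> z)"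
proof -
  define x y p q where "x = Re z" "y = Im z" "p = Re (\<alpha> 0)" "q = Im (\<alpha> 0)"
  note xy = this
  have g: "c * (x\<^sup>2 + y\<^sup>2) + 2 * d * x + e = 2 * k * y" "c * (p\<^sup>2 + q\<^sup>2) + 2 * d * p + e = 2 * k * q"
    using assms G_\<alpha>[of 0] by (simp_all add: Z_def G_def xy)
  have "Im ((z - \<alpha> 0) * cnj (B z))
    = y * (c * (p\<^sup>2 + q\<^sup>2) + 2 * d * p + e) - q * (c * (x\<^sup>2 + y\<^sup>2) + 2 * d * x + e)"
    unfolding B_def by (simp add: xy[symmetric] power2_eq_square algebra_simps)
  also have "\<dots> = 0" unfolding g by simp
  finally have "Im ((z - \<alpha> 0) / B z) = 0"
    by (simp add: complex_div_cnj[of "z - \<alpha> 0"])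
  then show ?thesis by (simp add: \<tau>_def complex_eq_iff)
qed

lemma \<tau>_bound:
  assumes "z \<in> Z"
  shows "m2 * (\<tau> z)\<^sup>2 < 1"
proof -
  have "(\<tau> z)\<^sup>2 = (norm (z - \<alpha> 0))\<^sup>2 / (norm (B z))\<^sup>2"
    using arg_cong[OF \<tau>_eq[OF assms], of norm]
    by (metis norm_divide norm_of_real power2_abs power_divide)
  moreover have "m2 * (norm (z - \<alpha> 0))\<^sup>2 < (norm (B z))\<^sup>2"
    unfolding norm_B[OF assms] using assms Im_pos[of 0] by (simp add: Z_def)
  ultimately show ?thesis
    using B_nz[OF assms] by (simp add: divide_less_eq)
qed

lemma Q_nz: "Q (\<alpha> s) \<noteq> 0"
  using \<alpha>'_eq[of s] \<alpha>'_nz[of s] by auto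

text \<open>On \<open>Z\<close>, \<tau> is a fractional linear map whose determinant is
  \<open>Q (\<alpha> 0)\<close>, which is nonzero.\<close>

lemma \<tau>_inj:
  assumes "z \<in> Z" "w \<in> Z" "\<tau> z = \<tau> w"
  shows "z = w"
proof -
  have "(z - \<alpha> 0) / B z = (w - \<alpha> 0) / B w"
    using assms \<tau>_eq by metis
  then have "(z - \<alpha> 0) * B w = (w - \<alpha> 0) * B z"
    using B_nz assms by (simp add: frac_eq_eq)
  then have "(z - w) * Q (\<alpha> 0) = 0"
    unfolding B_def Q_def by algebra
  then show ?thesis using Q_nz by simp
qed

lemma continuous_on_\<tau>: "continuous_on Z \<tau>"
  unfolding \<tau>_def using B_nz
  by (auto intro!: continuous_intros simp: B_def)

text \<open>The fractional linear map has derivative \<open>Q (\<alpha> 0) / (B z)\<^sup>2\<close>.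
  Multiplied by the velocity, a real multiple of \<open>Q (\<alpha> s)\<close>, it produces the
  product \<open>Q (\<alpha> s) * Q (\<alpha> 0)\<close> of \<open>B_Q\<close>.\<close>

lemma DERIV_\<tau>:
  "((\<lambda>s. \<tau> (\<alpha> s)) has_real_derivative r s / (2 * Im (\<alpha> s)) * (1 - m2 * (\<tau> (\<alpha> s))\<^sup>2)) (at s)"
proof -
  have B: "B (\<alpha> s) \<noteq> 0" using B_nz \<alpha>_in_Z by blast
  have dB: "(B has_field_derivative (of_real c * \<alpha> 0 + of_real d)) (at (\<alpha> s))"
    unfolding B_def[abs_def] by (auto intro!: derivative_eq_intros)
  have "((\<lambda>z. (z - \<alpha> 0) / B z) has_field_derivative Q (\<alpha> 0) / (B (\<alpha> s))\<^sup>2) (at (\<alpha> s))"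
  proof (rule DERIV_cong[OF DERIV_divide[OF DERIV_diff[OF DERIV_ident DERIV_const] dB B]])
    have "(1 - 0) * B (\<alpha> s) - (\<alpha> s - \<alpha> 0) * (of_real c * \<alpha> 0 + of_real d) = Q (\<alpha> 0)"
      unfolding B_def Q_def by algebra
    then show "((1 - 0) * B (\<alpha> s) - (\<alpha> s - \<alpha> 0) * (of_real c * \<alpha> 0 + of_real d))
        / (B (\<alpha> s) * B (\<alpha> s)) = Q (\<alpha> 0) / (B (\<alpha> s))\<^sup>2"
      by (simp add: power2_eq_square)
  qed
  from field_vector_diff_chain_at[OF has_vector_derivative_\<alpha> this]
  have "((\<lambda>s. (\<alpha> s - \<alpha> 0) / B (\<alpha> s)) has_vector_derivative
      \<alpha>' s * (Q (\<alpha> 0) / (B (\<alpha> s))\<^sup>2)) (at s)"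
    by (simp add: o_def)
  moreover have "\<alpha>' s * (Q (\<alpha> 0) / (B (\<alpha> s))\<^sup>2)
    = of_real (r s / (2 * Im (\<alpha> s)) * (1 - m2 * (\<tau> (\<alpha> s))\<^sup>2))"
  proof -
    have "Q (\<alpha> s) * Q (\<alpha> 0) / (B (\<alpha> s))\<^sup>2 = of_real (1 - m2 * (\<tau> (\<alpha> s))\<^sup>2)"
    proof -
      have "Q (\<alpha> s) * Q (\<alpha> 0) / (B (\<alpha> s))\<^sup>2
          = 1 - of_real m2 * ((\<alpha> s - \<alpha> 0) / B (\<alpha> s))\<^sup>2"
        using B unfolding B_Q[symmetric] unfolding power_divide
        by (simp add: diff_divide_distrib[of "(B (\<alpha> s))\<^sup>2"])
      then show ?thesis unfolding \<tau>_eq[OF \<alpha>_in_Z] by simp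
    qed
    then have "of_real (r s / (2 * Im (\<alpha> s))) * (Q (\<alpha> s) * Q (\<alpha> 0) / (B (\<alpha> s))\<^sup>2)
      = of_real (r s / (2 * Im (\<alpha> s))) * of_real (1 - m2 * (\<tau> (\<alpha> s))\<^sup>2)"
      by (rule arg_cong)
    then show ?thesis
      unfolding \<alpha>'_eq[of s] of_real_mult[symmetric] by (simp only: mult.assoc times_divide_eq_right)
  qed
  ultimately have "((\<lambda>s. Re ((\<alpha> s - \<alpha> 0) / B (\<alpha> s))) has_real_derivative
      r s / (2 * Im (\<alpha> s)) * (1 - m2 * (\<tau> (\<alpha> s))\<^sup>2)) (at s)"
    unfolding has_vector_derivative_complex_iff by (metis Re_complex_of_real)
  then show ?thesis by (simp add: \<tau>_def)
qed

section \<open>Completeness: the curve fills its circle or line inside the half-plane\<close>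

lemma continuous_on_\<alpha>: "continuous_on UNIV \<alpha>"
  using smooth by (rule smooth_on_continuous_on)

lemma continuous_on_r: "continuous_on UNIV r"
  using DERIV_isCont[OF DERIV_r] by (simp add: continuous_on_eq_continuous_at)

lemma arc_length:
  obtains F where "\<And>s. (F has_real_derivative r s / (2 * Im (\<alpha> s))) (at s)"
    "\<And>x. \<exists>s\<ge>0. F s > x" "\<And>x. \<exists>s\<le>0. F s < x"
proof -
  have "continuous_on UNIV (\<lambda>s. r s / (2 * Im (\<alpha> s)))"
    using Im_pos by (auto intro!: continuous_intros continuous_on_r continuous_on_\<alpha>
        simp: less_imp_neq[symmetric])
  then obtain F where F: "\<And>s. (F has_real_derivative r s / (2 * Im (\<alpha> s))) (at s)"
    by (rule antiderivative_UNIV) blast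
  have mono: "strict_mono F"
  proof (rule strict_monoI)
    fix x y :: real assume "x < y"
    then show "F x < F y"
      by (rule DERIV_pos_imp_increasing) (use F r_pos Im_pos in \<open>auto intro!: exI divide_pos_pos\<close>)
  qed
  \<comment> \<open>\<open>F\<close> is normalised to match the weight in
    \<open>DERIV_\<tau>\<close>; the factor \<open>2 / a\<close> turns it into hyperbolic arc
    length.\<close>
  define F' where "F' s = 2 / a * F s" for s
  have F': "(F' has_real_derivative speed \<kappa> \<alpha> s) (at s)" for s
    unfolding F'_def[abs_def] speed_eq using DERIV_cmult[OF F, of "2 / a"] by (simp add: mult.commute)
  have mono': "strict_mono F'"
    using mono a_pos by (auto simp: strict_mono_def F'_def divide_strict_right_mono)
  have int: "integral {x..y} (speed \<kappa> \<alpha>) = F' y - F' x" if "x \<le> y" for x y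
    using fundamental_theorem_of_calculus[OF that, of F' "speed \<kappa> \<alpha>"] F'
    by (auto simp: has_real_derivative_iff_has_vector_derivative has_vector_derivative_at_within
        intro!: integral_unique)
  have dist: "(\<lambda>s t. integral {min s t..max s t} (speed \<kappa> \<alpha>)) = (\<lambda>s t. \<bar>F' s - F' t\<bar>)"
  proof (intro ext)
    fix s t show "integral {min s t..max s t} (speed \<kappa> \<alpha>) = \<bar>F' s - F' t\<bar>"
      using int[of s t] int[of t s] strict_mono_less_eq[OF mono', of s t]
        strict_mono_less_eq[OF mono', of t s]
      by (cases "s \<le> t") (simp_all add: min_def max_def)
  qed
  have compl: "Metric_space.mcomplete UNIV (\<lambda>s t. \<bar>F' s - F' t\<bar>)"
    using complete by (simp add: complete_curve_def dist)
  \<comment> \<open>The arc length of the reversed curve. Its distance inherits completeness, since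
    reflecting the parameter is an isometry, and the bound above for \<open>H\<close> gives the
    missing bound below for \<open>F\<close>.\<close>
  define H where "H s = - F' (- s)" for s
  have monoH: "strict_mono H"
    using mono' by (auto simp: strict_mono_def H_def)
  interpret M: Metric_space UNIV "\<lambda>s t. \<bar>F' s - F' t\<bar>"
    using mono' by (rule metric_space_strict_mono)
  interpret H: Metric_space UNIV "\<lambda>s t. \<bar>H s - H t\<bar>"
    using monoH by (rule metric_space_strict_mono)
  have complH: "Metric_space.mcomplete UNIV (\<lambda>s t. \<bar>H s - H t\<bar>)"
    unfolding H.mcomplete_def
  proof (intro allI impI)
    fix \<sigma> assume "H.MCauchy \<sigma>"
    then have "M.MCauchy (\<lambda>n. - \<sigma> n)"
      unfolding H.MCauchy_def M.MCauchy_def by (simp add: H_def abs_minus_commute)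
    then obtain x where "limitin M.mtopology (\<lambda>n. - \<sigma> n) x sequentially"
      using compl unfolding M.mcomplete_def by blast
    then have "limitin H.mtopology \<sigma> (- x) sequentially"
      unfolding H.limitin_metric M.limitin_metric by (simp add: H_def abs_minus_commute)
    then show "\<exists>x. limitin H.mtopology \<sigma> x sequentially" by blast
  qed
  show ?thesis
  proof
    show "\<exists>s\<ge>0. F s > x" for x
      using complete_imp_unbounded[OF mono' compl, of "2 / a * x"] a_pos
      by (auto simp: F'_def mult_less_cancel_left_pos divide_less_cancel)
    show "\<exists>s\<le>0. F s < x" for x
    proof -
      obtain s where "s \<ge> 0" "H s > - (2 / a * x)"
        using complete_imp_unbounded[OF monoH complH] by blast
      then have "- s \<le> 0" "F (- s) < x"
        using a_pos by (auto simp: F'_def H_def mult_less_cancel_left_pos divide_less_cancel)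
      then show ?thesis by blast
    qed
  qed (rule F)
qed

lemma range_\<alpha>: "range \<alpha> = Z"
proof
  show "range \<alpha> \<subseteq> Z" using \<alpha>_in_Z by blast
  show "Z \<subseteq> range \<alpha>"
  proof
    fix z assume z: "z \<in> Z"
    obtain F where F: "\<And>s. (F has_real_derivative r s / (2 * Im (\<alpha> s))) (at s)"
      and unb: "\<And>x. \<exists>s\<ge>0. F s > x" "\<And>x. \<exists>s\<le>0. F s < x"
      by (rule arc_length) blast
    have "\<exists>s. \<tau> (\<alpha> s) = \<tau> z"
    proof (cases "0 \<le> \<tau> z")
      case True
      show ?thesis
        by (rule logistic_ivt[OF DERIV_\<tau> F, where t = "\<tau> z"])
          (use True m2_nonneg unb \<tau>_bound z \<alpha>_in_Z r_pos Im_pos in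
            \<open>auto simp: \<tau>_def[of "\<alpha> 0"]\<close>)
    next
      \<comment> \<open>Negative values are reached by running the curve backwards.\<close>
      case False
      have D: "((\<lambda>s. - \<tau> (\<alpha> (- s))) has_real_derivative
          r (- s) / (2 * Im (\<alpha> (- s))) * (1 - m2 * (- \<tau> (\<alpha> (- s)))\<^sup>2)) (at s)" for s
        using DERIV_minus[OF DERIV_\<tau>[of "- s", unfolded DERIV_mirror]] by simp
      have D2: "((\<lambda>s. - F (- s)) has_real_derivative r (- s) / (2 * Im (\<alpha> (- s)))) (at s)" for s
        using DERIV_minus[OF F[of "- s", unfolded DERIV_mirror]] by simp
      have unb': "\<exists>s\<ge>0. - F (- s) > x" for x
        using unb(2)[of "- x"] by (metis minus_le_iff neg_0_le_iff_le minus_minus less_minus_iff)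
      show ?thesis
      proof (rule logistic_ivt[OF D D2, where t = "- \<tau> z"])
        fix s assume "- \<tau> (\<alpha> (- s)) = - \<tau> z"
        then show ?thesis by auto
      qed (use False m2_nonneg unb' \<tau>_bound z \<alpha>_in_Z r_pos Im_pos in
            \<open>auto simp: \<tau>_def[of "\<alpha> 0"]\<close>)
    qed
    then show "z \<in> range \<alpha>" using \<tau>_inj z \<alpha>_in_Z by blast
  qed
qed

text \<open>Along the curve \<tau> is continuous and strictly increasing, hence has a continuous
  inverse \<open>g\<close> on its range. Composing \<open>g\<close> with \<tau>, which is continuous
  on all of \<open>Z\<close>, inverts \<alpha>.\<close>

lemma \<alpha>_homeomorphism: obtains \<beta> where "homeomorphism UNIV Z \<alpha> \<beta>"
proof -
  let ?f = "\<lambda>s. \<tau> (\<alpha> s)"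
  have "?f x < ?f y" if "x < y" for x y
    by (rule DERIV_pos_imp_increasing[OF that])
      (use DERIV_\<tau> \<tau>_bound[OF \<alpha>_in_Z] r_pos Im_pos in \<open>fastforce intro!: exI\<close>)
  then have "inj ?f" by (intro linorder_injI less_imp_neq)
  moreover have "continuous_on UNIV ?f"
    using DERIV_isCont[OF DERIV_\<tau>] by (simp add: continuous_on_eq_continuous_at)
  ultimately obtain g where g: "homeomorphism UNIV (range ?f) ?f g"
    using invariance_of_domain_homeomorphism[of UNIV ?f] by auto
  have "homeomorphism UNIV Z \<alpha> (\<lambda>z. g (\<tau> z))"
  proof (rule homeomorphismI)
    show "continuous_on Z (\<lambda>z. g (\<tau> z))"
      using homeomorphism_cont2[OF g]
      by (intro continuous_on_compose2[OF _ continuous_on_\<tau>]) (auto simp flip: range_\<alpha>)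
    show "g (\<tau> (\<alpha> s)) = s" for s using homeomorphism_apply1[OF g] by simp
    then show "\<alpha> (g (\<tau> z)) = z" if "z \<in> Z" for z using that unfolding range_\<alpha>[symmetric] by auto
  qed (use continuous_on_\<alpha> \<alpha>_in_Z in auto)
  then show ?thesis by (rule that)
qed

end

section \<open>The two sides of the curve\<close>

text \<open>Both sets are connected and open in \<open>S\<close>, so a connected subset of
  \<open>S\<close> that contains one of them cannot meet the other.\<close>

lemma components_two:
  fixes A B U V :: "'a::topological_space set"
  assumes "connected A" "connected B" "A \<noteq> {}" "B \<noteq> {}" "A \<inter> B = {}" "A \<union> B = S"
    and "open U" "open V" "A = S \<inter> U" "B = S \<inter> V"
  shows "components S = {A, B}"
proof -
  have max: "A \<in> components S"
    if "connected A" "A \<noteq> {}" "A \<inter> B = {}" "A \<union> B = S"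
      "open U" "open V" "A = S \<inter> U" "B = S \<inter> V" for A B U V :: "'a set"
  proof (unfold in_components_maximal, intro conjI allI impI)
    fix D assume D: "D \<noteq> {} \<and> A \<subseteq> D \<and> D \<subseteq> S \<and> connected D"
    have "U \<inter> V \<inter> D = {}" "D \<subseteq> U \<union> V"
      using D that(3,4,7,8) by auto
    then have "U \<inter> D = {} \<or> V \<inter> D = {}"
      using D that(5,6) by (intro connectedD) auto
    moreover have "A \<subseteq> U \<inter> D" using D that(7) by auto
    ultimately have "V \<inter> D = {}" using that(2) by auto
    then show "D = A" using D that(4,8) by auto
  qed (use that(1,2,4) in auto)
  have AB: "A \<in> components S" "B \<in> components S"
    using max[of A B U V] max[of B A V U] assms by (simp_all add: Int_commute Un_commute)
  have "C \<in> {A, B}" if C: "C \<in> components S" for C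
  proof -
    obtain x where "x \<in> C" using in_components_nonempty[OF C] by blast
    moreover have "C \<subseteq> S" using C by (rule in_components_subset)
    ultimately have "C \<inter> A \<noteq> {} \<or> C \<inter> B \<noteq> {}" using assms(6) by blast
    then show ?thesis using components_eq[OF C AB(1)] components_eq[OF C AB(2)] by auto
  qed
  with AB show ?thesis by auto
qed

context cgc_curve
begin

text \<open>Used with \<open>w\<close> equal to 1 or -1; the inequality is oriented so that the
  normal \<open>w *\<^sub>R n\<close> points into \<open>side w\<close>.\<close>

definition side :: "real \<Rightarrow> complex set" where
  "side w = {p. 0 < Im p \<and> w * G p < 0}"

lemma open_side: "open (side w)"
  unfolding side_def G_def
  by (intro open_Collect_conj open_Collect_less continuous_intros)

lemma connected_side_affine: "connected {p. 0 < Im p \<and> x * Re p + y * Im p < b}"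
proof -
  have "{p. 0 < Im p \<and> x * Re p + y * Im p < b}
    = {p. \<i> \<bullet> p > 0} \<inter> {p. Complex x y \<bullet> p < b}"
    by (auto simp: inner_complex_def)
  then show ?thesis
    by (metis convex_connected convex_Int convex_halfspace_lt convex_halfspace_gt)
qed

text \<open>If the curve is not a Euclidean line, an inversion centred at an end point of it on the boundary
  of the half-plane makes it one.\<close>

lemma connected_side: "connected (side w)"
proof (cases "c = 0")
  case True
  then have "side w = {p. 0 < Im p \<and> 2 * w * d * Re p + (- 2 * w * k) * Im p < - w * e}"
    by (auto simp: side_def G_def algebra_simps)
  then show ?thesis using connected_side_affine by metis
next
  case False
  \<comment> \<open>A real root of \<open>Q\<close>, which exists because \<open>m2\<close> is
    nonnegative: an ideal end point of the curve.\<close>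
  define \<rho> where "\<rho> = (sqrt m2 - d) / c"
  have "(c * \<rho> + d)\<^sup>2 = d\<^sup>2 - c * e"
    using False m2_nonneg by (simp add: \<rho>_def flip: m2_eq)
  then have "c * (c * \<rho>\<^sup>2 + 2 * d * \<rho> + e) = 0" by algebra
  then have \<rho>: "c * \<rho>\<^sup>2 + 2 * d * \<rho> + e = 0" using False by simp
  define S where "S = {v. 0 < Im v \<and> (- 2 * w * (c * \<rho> + d)) * Re v + (- 2 * w * k) * Im v < - w * c}"
  define \<phi> where "\<phi> v = of_real \<rho> - inverse v" for v :: complex
  \<comment> \<open>After clearing the denominator the coefficient of
    \<open>\<bar>v\<bar>\<^sup>2\<close> is the value of \<open>Q\<close> at \<rho>, hence zero, and
    only an affine expression remains.\<close>
  have G: "G (\<phi> v) * ((Re v)\<^sup>2 + (Im v)\<^sup>2) = - 2 * (c * \<rho> + d) * Re v - 2 * k * Im v + c"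
    if "0 < Im v" for v
  proof -
    define n where "n = (Re v)\<^sup>2 + (Im v)\<^sup>2"
    have "n \<noteq> 0" using that by (auto simp: n_def sum_power2_eq_zero_iff)
    have \<phi>: "Re (\<phi> v) = \<rho> - Re v / n" "Im (\<phi> v) = Im v / n"
      by (simp_all add: \<phi>_def n_def)
    have "G (\<phi> v) * n = c * (\<rho>\<^sup>2 * n - 2 * \<rho> * Re v + ((Re v)\<^sup>2 + (Im v)\<^sup>2) / n)
        + 2 * d * (\<rho> * n - Re v) - 2 * k * Im v + e * n"
      using \<open>n \<noteq> 0\<close> unfolding G_def \<phi> by (simp add: field_simps power2_eq_square)
    also have "((Re v)\<^sup>2 + (Im v)\<^sup>2) / n = 1" using \<open>n \<noteq> 0\<close> by (simp add: n_def)
    also have "c * (\<rho>\<^sup>2 * n - 2 * \<rho> * Re v + 1) + 2 * d * (\<rho> * n - Re v) - 2 * k * Im v + e * n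
        = - 2 * (c * \<rho> + d) * Re v - 2 * k * Im v + c"
      using \<rho> by algebra
    finally show ?thesis by (simp add: n_def)
  qed
  have pos: "0 < (Re v)\<^sup>2 + (Im v)\<^sup>2" if "0 < Im v" for v
    using that by (simp add: add_nonneg_pos)
  have iff: "v \<in> S \<longleftrightarrow> \<phi> v \<in> side w" if "0 < Im v" for v
  proof -
    have "w * G (\<phi> v) < 0 \<longleftrightarrow> w * G (\<phi> v) * ((Re v)\<^sup>2 + (Im v)\<^sup>2) < 0"
      using pos[OF that] by (simp add: mult_less_0_iff)
    also have "w * G (\<phi> v) * ((Re v)\<^sup>2 + (Im v)\<^sup>2)
        = w * (- 2 * (c * \<rho> + d) * Re v - 2 * k * Im v + c)"
      unfolding mult.assoc G[OF that] ..
    finally show ?thesis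
      using that pos[OF that] by (auto simp: S_def side_def \<phi>_def algebra_simps)
  qed
  have "side w = \<phi> ` S"
  proof (intro equalityI subsetI)
    fix p assume p: "p \<in> side w"
    define v where "v = inverse (of_real \<rho> - p)"
    have "0 < Im v"
    proof -
      have "0 < Im p" using p by (simp add: side_def)
      then have "0 < (Re (of_real \<rho> - p))\<^sup>2 + (Im (of_real \<rho> - p))\<^sup>2"
        by (simp add: add_nonneg_pos)
      with \<open>0 < Im p\<close> show ?thesis by (simp add: v_def)
    qed
    moreover have "\<phi> v = p" by (simp add: \<phi>_def v_def)
    ultimately show "p \<in> \<phi> ` S" using p iff by (metis imageI)
  qed (use iff in \<open>auto simp: S_def\<close>)
  moreover have "continuous_on S \<phi>"
    unfolding \<phi>_def by (intro continuous_intros) (auto simp: S_def)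
  moreover have "connected S" unfolding S_def by (rule connected_side_affine)
  ultimately show ?thesis using connected_continuous_image by metis
qed

section \<open>The unit normal and the sign of \<open>G\<close> along it\<close>

definition n :: "real \<Rightarrow> complex" where
  "n s = (a * Im (\<alpha> s)) *\<^sub>R Complex (- (d + c * Re (\<alpha> s))) (k - c * Im (\<alpha> s))"

text \<open>The normal is a quarter turn of the Killing field. This form contains no division by the
  speed, so smoothness and the derivative of \<open>n\<close> follow from a polynomial in
  \<alpha>.\<close>

lemma n_Q: "n s = of_real (a / 2) * \<i> * Q (\<alpha> s)"
  unfolding Q_eq[OF G_\<alpha>] n_def by (simp add: complex_eq_iff algebra_simps)

text \<open>\<open>G\<close> is quadratic, so its expansion along the straight line is exact. The
  linear term is negative because \<open>n\<close> points against the Euclidean gradient of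
  \<open>G\<close>, which has length 2 on the curve by \<open>unit_tangent\<close>.\<close>

lemma G_along_normal:
  "G (\<alpha> s + t *\<^sub>R n s) = a * Im (\<alpha> s) * t * (c * a * Im (\<alpha> s) * t - 2)"
proof -
  define x y A B where "x = Re (\<alpha> s)" "y = Im (\<alpha> s)" "A = d + c * x" "B = k - c * y"
  note xy = this
  have u: "B\<^sup>2 + A\<^sup>2 = 1" using unit_tangent[of s] by (simp add: xy)
  have G0: "c * (x\<^sup>2 + y\<^sup>2) + 2 * d * x - 2 * k * y + e = 0"
    using G_\<alpha>[of s] by (simp add: G_def xy)
  have n: "n s = Complex (- (a * y) * A) (a * y * B)"
    by (simp add: n_def xy complex_eq_iff algebra_simps)
  have "G (\<alpha> s + t *\<^sub>R n s) = c * ((x - t * (a * y) * A)\<^sup>2 + (y + t * (a * y) * B)\<^sup>2)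
      + 2 * d * (x - t * (a * y) * A) - 2 * k * (y + t * (a * y) * B) + e"
    unfolding G_def n by (simp add: xy(1,2) algebra_simps)
  also have "\<dots> = (c * (x\<^sup>2 + y\<^sup>2) + 2 * d * x - 2 * k * y + e)
      + c * (t * a * y)\<^sup>2 * (B\<^sup>2 + A\<^sup>2) - 2 * (t * a * y) * (A * (d + c * x) + B * (k - c * y))"
    by (simp add: power2_eq_square algebra_simps)
  also have "\<dots> = a * y * t * (c * a * y * t - 2)"
  proof -
    have "A * (d + c * x) + B * (k - c * y) = 1"
      unfolding xy(3)[symmetric] xy(4)[symmetric] using u by (simp add: power2_eq_square add.commute)
    then show ?thesis unfolding G0 u by (simp add: power2_eq_square algebra_simps)
  qed
  finally show ?thesis by (simp add: xy)
qed

text \<open>The neighbourhood is two-sided: positive \<open>t\<close> shows that the normal points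
  into the component, while both signs are used for the exterior conormal. The last clause keeps
  points with negative \<open>t\<close> out of the closure of the side.\<close>

lemma eventually_normal:
  assumes "w\<^sup>2 = 1"
  shows "\<forall>\<^sub>F t in at 0. 0 < Im (\<alpha> s + t *\<^sub>R w *\<^sub>R n s)
    \<and> (w * G (\<alpha> s + t *\<^sub>R w *\<^sub>R n s) < 0 \<longleftrightarrow> 0 < t) \<and> (0 < w * G (\<alpha> s + t *\<^sub>R w *\<^sub>R n s) \<longleftrightarrow> t < 0)"
proof -
  have "((\<lambda>t. Im (\<alpha> s + t *\<^sub>R w *\<^sub>R n s)) \<longlongrightarrow> Im (\<alpha> s + 0 *\<^sub>R w *\<^sub>R n s)) (at 0)"
    by (intro tendsto_intros)
  then have "\<forall>\<^sub>F t in at 0. 0 < Im (\<alpha> s + t *\<^sub>R w *\<^sub>R n s)"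
    by (rule order_tendstoD) (simp add: Im_pos)
  moreover have "((\<lambda>t. c * a * Im (\<alpha> s) * (t * w) - 2) \<longlongrightarrow> c * a * Im (\<alpha> s) * (0 * w) - 2) (at 0)"
    by (intro tendsto_intros)
  then have "\<forall>\<^sub>F t in at 0. c * a * Im (\<alpha> s) * (t * w) - 2 < 0"
    by (rule order_tendstoD) simp
  ultimately show ?thesis
  proof eventually_elim
    case (elim t)
    have "w * G (\<alpha> s + t *\<^sub>R w *\<^sub>R n s)
      = w\<^sup>2 * (a * Im (\<alpha> s) * t) * (c * a * Im (\<alpha> s) * (t * w) - 2)"
      using G_along_normal[of s "t * w"] by (simp add: power2_eq_square)
    then have "w * G (\<alpha> s + t *\<^sub>R w *\<^sub>R n s)
      = (a * Im (\<alpha> s)) * (t * (c * a * Im (\<alpha> s) * (t * w) - 2))"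
      using assms by simp
    moreover have "0 < a * Im (\<alpha> s)" using a_pos Im_pos by simp
    ultimately have "w * G (\<alpha> s + t *\<^sub>R w *\<^sub>R n s) < 0
        \<longleftrightarrow> t * (c * a * Im (\<alpha> s) * (t * w) - 2) < 0"
      "0 < w * G (\<alpha> s + t *\<^sub>R w *\<^sub>R n s) \<longleftrightarrow> 0 < t * (c * a * Im (\<alpha> s) * (t * w) - 2)"
      by (metis mult_less_cancel_left_pos mult_zero_right)+
    then show ?case
      using elim unfolding mult_less_0_iff zero_less_mult_iff by linarith
  qed
qed

lemma side_nonempty: assumes "w\<^sup>2 = 1" shows "side w \<noteq> {}"
proof -
  have "\<forall>\<^sub>F t in at_right (0::real). t \<in> {0<..}"
    by (simp add: eventually_at_filter)
  moreover have "\<forall>\<^sub>F t in at_right (0::real). 0 < Im (\<alpha> 0 + t *\<^sub>R w *\<^sub>R n 0)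
      \<and> (w * G (\<alpha> 0 + t *\<^sub>R w *\<^sub>R n 0) < 0 \<longleftrightarrow> 0 < t)"
    using filter_leD[OF at_le[OF subset_UNIV] eventually_normal[OF assms, of 0]]
    by eventually_elim blast
  ultimately have "\<forall>\<^sub>F t in at_right (0::real). \<alpha> 0 + t *\<^sub>R w *\<^sub>R n 0 \<in> side w"
    by eventually_elim (auto simp: side_def)
  then show ?thesis
    using eventually_happens'[OF trivial_limit_at_right_real] by blast
qed

lemma truncated_cylinder_eq: "truncated_cylinder \<alpha> L = Z \<times> {0..L}"
  by (auto simp: truncated_cylinder_def vertical_cylinder_def range_\<alpha>)

lemma components_slab:
  assumes "0 < L"
  shows "components (slab L - truncated_cylinder \<alpha> L) = {side 1 \<times> {0..L}, side (- 1) \<times> {0..L}}"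
proof (rule components_two)
  show "connected (side 1 \<times> {0..L})" "connected (side (- 1) \<times> {0..L})"
    by (intro connected_Times connected_side connected_Icc)+
  show "side 1 \<times> {0..L} \<noteq> {}" "side (- 1) \<times> {0..L} \<noteq> {}"
    using assms side_nonempty[of 1] side_nonempty[of "- 1"] by auto
  show "open (side 1 \<times> (UNIV :: real set))" "open (side (- 1) \<times> (UNIV :: real set))"
    by (intro open_Times open_side open_UNIV)+
qed (auto simp: truncated_cylinder_eq slab_def hyp_plane_def Z_def side_def)

lemma sides_distinct:
  fixes L :: real
  assumes "0 < L" shows "side 1 \<times> {0..L} \<noteq> side (- 1) \<times> {0..L}"
proof
  assume eq: "side 1 \<times> {0..L} = side (- 1) \<times> {0..L}"
  have "side 1 \<inter> side (- 1) = {}" by (auto simp: side_def)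
  moreover obtain p where "p \<in> side 1" using side_nonempty[of 1] by auto
  then have "(p, 0) \<in> side (- 1) \<times> {0..L}"
    unfolding eq[symmetric] using assms by simp
  ultimately show False using \<open>p \<in> side 1\<close> by auto
qed

section \<open>The cylinder as a capillary surface\<close>

abbreviation g :: "(complex \<times> real) riem" where "g \<equiv> product_metric \<kappa>"
abbreviation X :: "real \<times> real \<Rightarrow> complex \<times> real" where "X \<equiv> cylinder_param \<alpha>"

definition N :: "real \<Rightarrow> real \<times> real \<Rightarrow> complex \<times> real" where
  "N w q = (w *\<^sub>R n (fst q), 0)"

definition n' :: "real \<Rightarrow> complex" where
  "n' s = of_real (a / 2) * \<i> * (2 * of_real c * \<alpha> s + 2 * of_real d) * \<alpha>' s"

definition E :: "real \<Rightarrow> real" where "E s = (r s)\<^sup>2 / (a * Im (\<alpha> s))\<^sup>2"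

lemma E_pos: "0 < E s"
  using r_pos[of s] a_pos Im_pos[of s] by (simp add: E_def)

lemma X_in: "X q \<in> product_space"
  by (simp add: product_space_def hyp_plane_def cylinder_param_def Im_pos)

lemma has_vector_derivative_n: "(n has_vector_derivative n' s) (at s)"
proof -
  have "((\<lambda>z. of_real (a / 2) * \<i> * Q z) has_field_derivative
      of_real (a / 2) * \<i> * (2 * of_real c * \<alpha> s + 2 * of_real d)) (at (\<alpha> s))"
    unfolding Q_def by (auto intro!: derivative_eq_intros simp: algebra_simps)
  from field_vector_diff_chain_at[OF has_vector_derivative_\<alpha> this]
  show ?thesis
    by (simp add: o_def n_Q[abs_def] n'_def mult_ac)
qed

lemma has_derivative_comp_fst:
  assumes "(f has_vector_derivative f') (at (fst q))"
  shows "((\<lambda>q. f (fst q)) has_derivative (\<lambda>v. fst v *\<^sub>R f')) (at q)"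
  using diff_chain_at[OF bounded_linear_imp_has_derivative[OF bounded_linear_fst]
      assms[unfolded has_vector_derivative_def]] by (simp add: o_def)

lemma frechet_X: "frechet_derivative X (at q) v = (fst v *\<^sub>R \<alpha>' (fst q), snd v)"
proof (rule frechet_derivativeI)
  show "(X has_derivative (\<lambda>v. (fst v *\<^sub>R \<alpha>' (fst q), snd v))) (at q)"
    unfolding cylinder_param_def
    by (intro has_derivative_Pair has_derivative_comp_fst has_vector_derivative_\<alpha>
        bounded_linear_imp_has_derivative bounded_linear_snd)
qed

lemma frechet_N: "frechet_derivative (N w) (at q) v = (fst v *\<^sub>R w *\<^sub>R n' (fst q), 0)"
proof -
  have "(N w has_derivative (\<lambda>v. (w *\<^sub>R fst v *\<^sub>R n' (fst q), 0))) (at q)"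
    unfolding N_def
    by (intro has_derivative_Pair has_derivative_scaleR_right has_derivative_comp_fst
        has_vector_derivative_n has_derivative_const)
  from frechet_derivativeI[OF this] show ?thesis by (simp add: mult.commute)
qed

lemma smooth_comp_fst: "smooth_on UNIV f \<Longrightarrow> smooth_on UNIV (\<lambda>q::real \<times> real. f (fst q))"
  by (rule smooth_on_comp_bounded_linear[OF bounded_linear_fst])

lemma smooth_X: "smooth_on UNIV X"
proof -
  have "smooth_on UNIV (\<lambda>q::real \<times> real. (\<alpha> (fst q), 0::real))"
    by (rule smooth_on_bounded_linear_comp[OF bounded_linear_Pair[OF bounded_linear_ident
            bounded_linear_zero] smooth_comp_fst[OF smooth]])
  moreover have "smooth_on UNIV (\<lambda>q::real \<times> real. (0::complex, snd q) + 0)"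
    by (intro smooth_on_affine bounded_linear_Pair bounded_linear_zero bounded_linear_snd open_UNIV)
  ultimately have "smooth_on UNIV (\<lambda>q::real \<times> real. (\<alpha> (fst q), 0) + ((0, snd q) + 0))"
    by (rule smooth_on_add)
  then show ?thesis by (simp add: cylinder_param_def[abs_def])
qed

lemma smooth_n: "smooth_on UNIV n"
  unfolding n_Q[abs_def] Q_def power2_eq_square
  by (intro smooth_on_add smooth_on_mult smooth_on_const smooth open_UNIV)

lemma smooth_N: "smooth_on UNIV (N w)"
proof -
  have "bounded_linear (\<lambda>z. (w *\<^sub>R z :: complex, 0 :: real))"
    by (intro bounded_linear_Pair bounded_linear_scaleR_right bounded_linear_zero)
  from smooth_on_bounded_linear_comp[OF this smooth_comp_fst[OF smooth_n]]
  show ?thesis by (simp add: N_def[abs_def])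
qed

section \<open>Fundamental forms of the cylinder\<close>

lemma n_Complex: "n s = (a * Im (\<alpha> s) / r s) *\<^sub>R (\<i> * \<alpha>' s)"
  using r_pos[of s] by (simp add: n_def complex_eq_iff Re_\<alpha>' Im_\<alpha>' algebra_simps)

lemma n_tangent: "n s \<bullet> \<alpha>' s = 0"
  unfolding n_Complex by (simp add: inner_complex_def)

lemma n_unit: "n s \<bullet> n s = (a * Im (\<alpha> s))\<^sup>2"
proof -
  have "n s \<bullet> n s = (a * Im (\<alpha> s))\<^sup>2 * ((k - c * Im (\<alpha> s))\<^sup>2 + (d + c * Re (\<alpha> s))\<^sup>2)"
    unfolding n_def by (simp add: inner_complex_def power2_eq_square algebra_simps)
  then show ?thesis unfolding unit_tangent by simp
qed

lemma hyp_metric_\<alpha>: "hyp_metric \<kappa> (\<alpha> s) v w = (v \<bullet> w) / (a * Im (\<alpha> s))\<^sup>2"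
  by (simp add: hyp_metric_def power_mult_distrib a_sq)

lemma first_ff_X: "first_ff g X = strip_metric E"
proof (intro ext)
  fix q v w :: "real \<times> real"
  have "\<alpha>' (fst q) \<bullet> \<alpha>' (fst q) = (r (fst q))\<^sup>2"
    by (simp add: r_def power2_norm_eq_inner)
  then show "first_ff g X q v w = strip_metric E q v w"
    by (simp add: first_ff_def frechet_X product_metric_def cylinder_param_def hyp_metric_\<alpha>
        strip_metric_def E_def mult_ac)
qed

text \<open>The Frenet equation: the covariant derivative of the unit normal of a curve is
  \<open>- \<kappa>\<^sub>g\<close> times its velocity. The terms in \<open>c\<close> from the
  Euclidean derivative and from the Christoffel form cancel, leaving \<open>a * k\<close>.\<close>

lemma covariant_normal:
  "(n' s - (1 / Im (\<alpha> s)) *\<^sub>R chr_form (\<alpha>' s) (n s)) \<bullet> \<alpha>' s = - \<kappa>\<^sub>g * (r s)\<^sup>2"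
proof -
  define y where "y = Im (\<alpha> s)"
  have y: "y \<noteq> 0" using Im_pos[of s] by (simp add: y_def)
  have "\<alpha>' s \<bullet> n s = 0" using n_tangent[of s] by (simp add: inner_commute)
  then have "chr_form (\<alpha>' s) (n s) \<bullet> \<alpha>' s = Im (n s) * (r s)\<^sup>2"
    unfolding chr_form_def using n_tangent[of s]
    by (simp add: inner_add_left r_def power2_norm_eq_inner)
  moreover have "n' s \<bullet> \<alpha>' s = - a * c * y * (r s)\<^sup>2"
    unfolding n'_def r_sq by (simp add: inner_complex_def y_def power2_eq_square algebra_simps)
  moreover have "Im (n s) = a * y * (k - c * y)" by (simp add: n_def y_def)
  ultimately have "(n' s - (1 / y) *\<^sub>R chr_form (\<alpha>' s) (n s)) \<bullet> \<alpha>' s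
      = - a * c * y * (r s)\<^sup>2 - (1 / y) * (a * y * (k - c * y) * (r s)\<^sup>2)"
    by (simp add: inner_diff_left)
  also have "\<dots> = - (a * k) * (r s)\<^sup>2"
    using y by (simp add: field_simps)
  finally show ?thesis using a_pos by (simp add: y_def k_def)
qed

text \<open>The vertical rulings are geodesics along which the normal is parallel, so only the entry
  in the direction of the base curve survives.\<close>

lemma second_ff_X:
  "second_ff g X (N w) q v v' = w * \<kappa>\<^sub>g * E (fst q) * fst v * fst v'"
proof -
  let ?s = "fst q"
  have y: "Im (fst (X q)) \<noteq> 0" "\<kappa> \<noteq> 0"
    using Im_pos[of ?s] neg by (simp_all add: cylinder_param_def)
  have "covd g X (N w) q v
      = ((fst v * w) *\<^sub>R (n' ?s - (1 / Im (\<alpha> ?s)) *\<^sub>R chr_form (\<alpha>' ?s) (n ?s)), 0)"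
    unfolding covd_def frechet_X frechet_N christoffel_product_metric[OF y]
    by (simp add: cylinder_param_def N_def chr_form_def algebra_simps)
  then have "second_ff g X (N w) q v v' = - (fst v * w * fst v'
      * ((n' ?s - (1 / Im (\<alpha> ?s)) *\<^sub>R chr_form (\<alpha>' ?s) (n ?s)) \<bullet> \<alpha>' ?s) / (a * Im (\<alpha> ?s))\<^sup>2)"
    by (simp add: second_ff_def product_metric_def frechet_X cylinder_param_def hyp_metric_\<alpha>)
  then show ?thesis unfolding covariant_normal by (simp add: E_def mult_ac)
qed

lemma shape_op_X: "shape_op g X (N w) q v = (w * \<kappa>\<^sub>g * fst v, 0)"
proof -
  have "linear (second_ff g X (N w) q v)"
    by (simp add: linear_iff second_ff_X algebra_simps)
  from sharp_strip_metric[OF _ this, of E q] E_pos[of "fst q"] show ?thesis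
    by (simp add: shape_op_def first_ff_X second_ff_X)
qed

lemma mean_curvature_X: "mean_curvature g X (N w) q = w * \<kappa>\<^sub>g / 2"
  by (simp add: mean_curvature_def trace_of_real_times_real shape_op_X)

lemma norm_sff_sq_X: "w\<^sup>2 = 1 \<Longrightarrow> norm_sff_sq g X (N w) q = \<kappa>\<^sub>g\<^sup>2"
  by (simp add: norm_sff_sq_def trace_of_real_times_real shape_op_X power2_eq_square)

lemma N_unit: "w\<^sup>2 = 1 \<Longrightarrow> g (X q) (N w q) (N w q) = 1"
  using a_pos Im_pos[of "fst q"]
  by (simp add: product_metric_def cylinder_param_def hyp_metric_\<alpha> N_def n_unit power2_eq_square)

lemma Ric_X: "w\<^sup>2 = 1 \<Longrightarrow> Ric g (X q) (N w q) = \<kappa>"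
  using Ric_product_metric[OF X_in, of \<kappa> q "N w q"] neg N_unit[of w q]
  by (simp add: product_metric_def N_def)

lemma N_normal: "g (X q) (N w q) (frechet_derivative X (at q) v) = 0"
  by (simp add: product_metric_def cylinder_param_def hyp_metric_\<alpha> N_def n_tangent frechet_X)

text \<open>An affine interpolation between -1 at height 0 and 1 at height \<open>L\<close>, so that
  one smooth field gives the outward normal on both slices.\<close>

definition Nt :: "real \<Rightarrow> complex \<times> real \<Rightarrow> complex \<times> real" where
  "Nt L p = (0, 2 * snd p / L - 1)"

lemma embedded_X: "embedded_strip X L"
  unfolding embedded_strip_def
proof (intro conjI ballI)
  show "smooth_near (strip L) X"
    unfolding smooth_near_def using smooth_X by blast
  show "inj (frechet_derivative X (at q))" for q
    using \<alpha>'_nz by (auto simp: inj_on_def frechet_X prod_eq_iff)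
  obtain \<beta> where \<beta>: "homeomorphism UNIV Z \<alpha> \<beta>" using \<alpha>_homeomorphism .
  have "homeomorphism (strip L) (X ` strip L) X (\<lambda>p. (\<beta> (fst p), snd p))"
  proof (rule homeomorphismI)
    show "continuous_on (strip L) X"
      using smooth_on_continuous_on[OF smooth_X] continuous_on_subset by blast
    have "fst ` X ` strip L \<subseteq> Z" by (auto simp: cylinder_param_def \<alpha>_in_Z)
    then have "continuous_on (X ` strip L) (\<lambda>p. \<beta> (fst p))"
      by (intro continuous_on_compose2[OF homeomorphism_cont2[OF \<beta>]] continuous_intros) auto
    then show "continuous_on (X ` strip L) (\<lambda>p. (\<beta> (fst p), snd p))"
      by (intro continuous_intros)
  qed (use homeomorphism_apply1[OF \<beta>] in \<open>auto simp: cylinder_param_def\<close>)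
  then show "\<exists>Y. homeomorphism (strip L) (X ` strip L) X Y" by blast
qed

text \<open>The slices are a distance \<open>L\<close> apart, so by continuity a curve in their
  union has constant height near its base point.\<close>

lemma tangent_vector_slices:
  assumes L: "0 < L" and v: "tangent_vector (horizontal_slice 0 \<union> horizontal_slice L) p v"
  shows "snd v = 0"
proof -
  obtain \<gamma> where \<gamma>: "\<gamma> 0 = p" "(\<gamma> has_vector_derivative v) (at 0)"
    "\<forall>\<^sub>F t in at (0::real). \<gamma> t \<in> horizontal_slice 0 \<union> horizontal_slice L"
    using v unfolding tangent_vector_def by blast
  have "isCont \<gamma> 0" using \<gamma>(2) has_vector_derivative_continuous by blast
  then have lim: "((\<lambda>t. snd (\<gamma> t)) \<longlongrightarrow> snd p) (at 0)"
    using tendsto_snd[of \<gamma> p] \<gamma>(1) by (simp add: isCont_def)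
  have "\<forall>\<^sub>F t in at 0. dist (snd (\<gamma> t)) (snd p) < L / 2"
    using tendstoD[OF lim, of "L / 2"] L by simp
  have sn: "\<forall>\<^sub>F t in at (0::real). snd (\<gamma> t) = 0 \<or> snd (\<gamma> t) = L"
    using \<gamma>(3) by eventually_elim (auto simp: horizontal_slice_def)
  have "closed {0, L}" by simp
  then have "snd p \<in> {0, L}"
    by (rule Lim_in_closed_set[OF _ _ _ lim]) (use sn in \<open>auto elim: eventually_mono\<close>)
  have "\<forall>\<^sub>F t in at 0. snd (\<gamma> t) = snd p"
    using sn \<open>\<forall>\<^sub>F t in at 0. dist (snd (\<gamma> t)) (snd p) < L / 2\<close>
    by eventually_elim (use \<open>snd p \<in> {0, L}\<close> L in \<open>auto simp: dist_real_def\<close>)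
  moreover have "((\<lambda>t. snd (\<gamma> t)) has_vector_derivative snd v) (at 0)"
    using bounded_linear.has_vector_derivative[OF bounded_linear_snd \<gamma>(2)] .
  ultimately have "((\<lambda>t. snd p) has_vector_derivative snd v) (at 0)"
    unfolding has_vector_derivative_def
    using has_derivative_transform_eventually[of "\<lambda>t. snd (\<gamma> t)" _ 0 UNIV "\<lambda>t. snd p"] \<gamma>(1)
    by simp
  then show ?thesis
    using vector_derivative_at by (metis vector_derivative_const_at)
qed

lemma outward_Nt:
  assumes L: "0 < L"
  shows "outward_unit_normal g product_space (slab L) (Nt L)"
  unfolding outward_unit_normal_def bd_slab[OF L]
proof (intro conjI ballI allI impI)
  have "bounded_linear (\<lambda>p::complex \<times> real. (0::complex, (2 / L) * snd p))"
    by (intro bounded_linear_Pair bounded_linear_zero bounded_linear_const_mult bounded_linear_snd)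
  from smooth_on_affine[OF this open_UNIV, of "(0, -1)"]
  have "smooth_on UNIV (Nt L)" by (simp add: Nt_def[abs_def])
  then show "smooth_near (horizontal_slice 0 \<union> horizontal_slice L) (Nt L)"
    unfolding smooth_near_def by blast
  fix p assume p: "p \<in> horizontal_slice 0 \<union> horizontal_slice L"
  then show "g p (Nt L p) (Nt L p) = 1"
    using L by (auto simp: horizontal_slice_def product_metric_def hyp_metric_def Nt_def)
  show "g p (Nt L p) v = 0" if "tangent_vector (horizontal_slice 0 \<union> horizontal_slice L) p v" for v
    using tangent_vector_slices[OF L that] by (simp add: product_metric_def hyp_metric_def Nt_def)
  have "\<forall>\<^sub>F t in at_right (0::real). t \<in> {0<..<L}"
    using L by (rule eventually_at_right_real)
  then show "\<forall>\<^sub>F t in at_right 0. p + t *\<^sub>R Nt L p \<notin> slab L \<and> p - t *\<^sub>R Nt L p \<in> slab L"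
    by eventually_elim (use p L in \<open>auto simp: horizontal_slice_def slab_def Nt_def\<close>)
qed

text \<open>At heights 0 and \<open>L\<close> no point is interior to the product, so there the
  frontier coincides with the closure. This describes the wetted region on each slice.\<close>

lemma frontier_side:
  fixes L z :: real
  assumes "0 < L" "0 < Im p" "z \<in> {0, L}"
  shows "(p, z) \<in> frontier (side w \<times> {0..L}) \<longleftrightarrow> p \<in> closure (side w)"
proof -
  have "interior (side w \<times> {0..L}) = side w \<times> {0<..<L}"
    by (simp add: interior_Times interior_open open_side interior_atLeastAtMost_real)
  moreover have "closure (side w \<times> {0..L}) = closure (side w) \<times> {0..L}"
    by (simp add: closure_Times)
  ultimately show ?thesis using assms by (auto simp: frontier_def)
qed

lemma closure_side: "p \<in> closure (side w) \<Longrightarrow> w * G p \<le> 0"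
proof -
  have "closed {p. w * G p \<le> 0}"
    unfolding G_def by (intro closed_Collect_le continuous_intros)
  moreover have "side w \<subseteq> {p. w * G p \<le> 0}" by (auto simp: side_def)
  ultimately have "closure (side w) \<subseteq> {p. w * G p \<le> 0}" by (rule closure_minimal[rotated])
  then show "p \<in> closure (side w) \<Longrightarrow> w * G p \<le> 0" by blast
qed

text \<open>The contact angle is a right angle, so \<open>N\<close> is tangent to the slice and
  points into the wetted region; its negative is the exterior conormal, with a straight segment as
  the curve required by the definition.\<close>

lemma exterior_conormal:
  assumes L: "0 < L" and w: "w\<^sup>2 = 1" and q: "q \<in> strip_bd L"
  shows "exterior_conormal_in g (bd_in product_space (slab L))
    (frontier (side w \<times> {0..L}) \<inter> bd_in product_space (slab L)) (X q)
    (frechet_derivative X (at q) (1, 0)) (- N w q)"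
  unfolding exterior_conormal_in_def
proof (intro conjI exI)
  have [simp]: "g p (- u) v = - g p u v" "g p u (- v) = - g p u v" for p u v
    by (simp_all add: product_metric_def hyp_metric_def)
  show "g (X q) (- N w q) (- N w q) = 1" using N_unit[OF w] by simp
  show "g (X q) (- N w q) (frechet_derivative X (at q) (1, 0)) = 0" using N_normal by simp
  let ?\<gamma> = "\<lambda>t. X q + t *\<^sub>R - N w q"
  show "?\<gamma> 0 = X q" by simp
  show "(?\<gamma> has_vector_derivative - N w q) (at 0)"
    by (auto intro!: derivative_eq_intros)
  have ev: "\<forall>\<^sub>F t in at 0. P (- t)" if "\<forall>\<^sub>F t in at 0. P t" for P :: "real \<Rightarrow> bool"
    using that eventually_filtermap[of P uminus "at 0"] filtermap_at_minus[of "0::real"] by simp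
  have z: "snd q \<in> {0, L}" using q by (auto simp: strip_bd_def)
  \<comment> \<open>For \<open>t \<noteq> 0\<close> the case \<open>t \<le> 0\<close> puts the point
    into the open side itself, hence into its closure.\<close>
  have "\<forall>\<^sub>F t in at (0::real). t \<noteq> 0" by (simp add: eventually_at_filter)
  with ev[OF eventually_normal[OF w, of "fst q"]]
  show "\<forall>\<^sub>F t in at 0. ?\<gamma> t \<in> bd_in product_space (slab L)
    \<and> (?\<gamma> t \<in> frontier (side w \<times> {0..L}) \<inter> bd_in product_space (slab L) \<longleftrightarrow> t \<le> 0)"
  proof eventually_elim
    case (elim t)
    define p where "p = \<alpha> (fst q) + (- t) *\<^sub>R w *\<^sub>R n (fst q)"
    have p: "0 < Im p" "w * G p < 0 \<longleftrightarrow> 0 < - t" "0 < w * G p \<longleftrightarrow> - t < 0"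
      using elim(1) unfolding p_def by blast+
    have \<gamma>: "?\<gamma> t = (p, snd q)"
      by (simp add: cylinder_param_def N_def p_def)
    have "(p, snd q) \<in> bd_in product_space (slab L)"
      using p(1) z by (auto simp: bd_slab[OF L] horizontal_slice_def hyp_plane_def)
    moreover have "(p, snd q) \<in> frontier (side w \<times> {0..L}) \<longleftrightarrow> t \<le> 0"
      unfolding frontier_side[OF L p(1) z]
    proof
      assume "p \<in> closure (side w)"
      from closure_side[OF this] p(3) show "t \<le> 0" by linarith
    next
      assume "t \<le> 0"
      with elim(2) p have "p \<in> side w" by (auto simp: side_def)
      then show "p \<in> closure (side w)" using closure_subset by blast
    qed
    ultimately show ?case unfolding \<gamma> by simp
  qed
qed

lemma points_into_side:
  assumes w: "w\<^sup>2 = 1" and q: "q \<in> strip L"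
  shows "\<forall>\<^sub>F t in at_right (0::real). X q + t *\<^sub>R N w q \<in> side w \<times> {0..L}"
proof -
  have "\<forall>\<^sub>F t in at_right (0::real). t \<in> {0<..}"
    by (simp add: eventually_at_filter)
  moreover have "\<forall>\<^sub>F t in at_right 0. 0 < Im (\<alpha> (fst q) + t *\<^sub>R w *\<^sub>R n (fst q))
    \<and> (w * G (\<alpha> (fst q) + t *\<^sub>R w *\<^sub>R n (fst q)) < 0 \<longleftrightarrow> 0 < t)
    \<and> (0 < w * G (\<alpha> (fst q) + t *\<^sub>R w *\<^sub>R n (fst q)) \<longleftrightarrow> t < 0)"
    using filter_leD[OF at_le[OF subset_UNIV] eventually_normal[OF w, of "fst q"]] .
  ultimately show ?thesis
    by eventually_elim (use q in \<open>auto simp: side_def cylinder_param_def N_def strip_def\<close>)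
qed

lemma capillary_cylinder:
  assumes L: "0 < L" and w: "w = 1 \<or> w = - 1"
  shows "capillary_surface g product_space (slab L) X L (side w \<times> {0..L}) (N w) (Nt L)
    (\<lambda>q. - N w q) (pi / 2)"
  unfolding capillary_surface_def
proof (intro conjI ballI allI)
  have w2: "w\<^sup>2 = 1" using w by auto
  show "embedded_strip X L" by (rule embedded_X)
  have "hyp_plane \<times> {0<..<L} \<subseteq> interior (slab L)"
    unfolding hyp_plane_def by (intro interior_maximal open_Times open_halfspace_Im_gt)
      (auto simp: slab_def hyp_plane_def)
  then show "X ` (strip L - strip_bd L) \<subseteq> interior (slab L)"
    by (force simp: strip_def strip_bd_def cylinder_param_def hyp_plane_def Im_pos)
  show "X ` strip_bd L \<subseteq> bd_in product_space (slab L)"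
    unfolding bd_slab[OF L]
    by (auto simp: strip_bd_def cylinder_param_def horizontal_slice_def hyp_plane_def Im_pos)
  show "card (components (slab L - X ` strip L)) = 2"
    unfolding cylinder_param_image components_slab[OF L] using sides_distinct[OF L] by simp
  show "side w \<times> {0..L} \<in> components (slab L - X ` strip L)"
    unfolding cylinder_param_image components_slab[OF L] using w by auto
  show "smooth_near (strip L) (N w)"
    unfolding smooth_near_def using smooth_N by blast
  show "g (X q) (N w q) (N w q) = 1" for q using N_unit[OF w2] .
  show "g (X q) (N w q) (frechet_derivative X (at q) v) = 0" for q v by (rule N_normal)
  show "\<forall>\<^sub>F t in at_right 0. X q + t *\<^sub>R N w q \<in> side w \<times> {0..L}"
    if "q \<in> strip L - strip_bd L" for q
    using points_into_side[OF w2] that by blast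
  show "outward_unit_normal g product_space (slab L) (Nt L)" using L by (rule outward_Nt)
  show "exterior_conormal_in g (bd_in product_space (slab L))
    (frontier (side w \<times> {0..L}) \<inter> bd_in product_space (slab L)) (X q)
    (frechet_derivative X (at q) (1, 0)) (- N w q)" if "q \<in> strip_bd L" for q
    using exterior_conormal[OF L w2 that] .
  show "\<exists>H. \<forall>q\<in>strip L. mean_curvature g X (N w) q = H"
    using mean_curvature_X by blast
  show "g (X q) (N w q) (Nt L (X q)) = cos (pi / 2)" for q
    by (simp add: product_metric_def hyp_metric_def N_def Nt_def)
qed (simp_all add: pi_gt_zero)

end

section \<open>The second variation\<close>

text \<open>Passes from the Lebesgue integrals in the definition of the second variation to
  integrals over boxes, where the fundamental theorem of calculus and the interchange of integrals
  for continuous functions apply.\<close>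

lemma lborel_integral_eq_integral_compact:
  fixes f h :: "'a::euclidean_space \<Rightarrow> real"
  assumes "compact B" "continuous_on B h"
    and "\<And>x. x \<in> B \<Longrightarrow> f x = h x" "\<And>x. x \<notin> B \<Longrightarrow> f x = 0"
  shows "(LINT x|lborel. f x) = integral B h"
proof -
  have "set_integrable lborel B h"
    unfolding set_integrable_def using assms(1,2) by (rule borel_integrable_compact)
  from set_borel_integral_eq_integral(2)[OF this]
  have "integral B h = (LINT x|lborel. indicator B x *\<^sub>R h x)"
    by (simp add: set_lebesgue_integral_def)
  also have "\<dots> = (LINT x|lborel. f x)"
    using assms(3,4) by (intro Bochner_Integration.integral_cong) (auto simp: indicator_def)
  finally show ?thesis ..
qed

lemma DERIV_fst_slice:
  assumes "f differentiable (at (s, t))"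
  shows "((\<lambda>s. f (s, t)) has_real_derivative frechet_derivative f (at (s, t)) (1, 0)) (at s)"
proof -
  have D: "(f has_derivative frechet_derivative f (at (s, t))) (at (s, t))"
    using assms by (rule has_derivative_frechet)
  have "((\<lambda>s::real. (s, t)) has_derivative (\<lambda>x. (x, 0))) (at s)"
    by (intro has_derivative_Pair has_derivative_ident has_derivative_const)
  from diff_chain_at[OF this D]
  have "((\<lambda>s. f (s, t)) has_derivative (\<lambda>x. frechet_derivative f (at (s, t)) (x, 0))) (at s)"
    by (simp add: o_def)
  moreover have "(\<lambda>x. frechet_derivative f (at (s, t)) (x, 0)) = (*) (frechet_derivative f (at (s, t)) (1, 0))"
  proof
    fix x
    show "frechet_derivative f (at (s, t)) (x, 0) = frechet_derivative f (at (s, t)) (1, 0) * x"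
      using linear_cmul[OF linear_frechet_derivative[OF assms], of x "(1, 0)"]
      by (simp add: mult.commute)
  qed
  ultimately show ?thesis unfolding has_field_derivative_def by simp
qed

lemma DERIV_snd_slice:
  assumes "f differentiable (at (s, t))"
  shows "((\<lambda>t. f (s, t)) has_real_derivative frechet_derivative f (at (s, t)) (0, 1)) (at t)"
proof -
  have D: "(f has_derivative frechet_derivative f (at (s, t))) (at (s, t))"
    using assms by (rule has_derivative_frechet)
  have "((\<lambda>t::real. (s, t)) has_derivative (\<lambda>x. (0, x))) (at t)"
    by (intro has_derivative_Pair has_derivative_ident has_derivative_const)
  from diff_chain_at[OF this D]
  have "((\<lambda>t. f (s, t)) has_derivative (\<lambda>x. frechet_derivative f (at (s, t)) (0, x))) (at t)"
    by (simp add: o_def)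
  moreover have "(\<lambda>x. frechet_derivative f (at (s, t)) (0, x)) = (*) (frechet_derivative f (at (s, t)) (0, 1))"
  proof
    fix x
    show "frechet_derivative f (at (s, t)) (0, x) = frechet_derivative f (at (s, t)) (0, 1) * x"
      using linear_cmul[OF linear_frechet_derivative[OF assms], of x "(0, 1)"]
      by (simp add: mult.commute)
  qed
  ultimately show ?thesis unfolding has_field_derivative_def by simp
qed

lemma area_density_strip_metric: "area_density (strip_metric E) q = sqrt (E (fst q))"
  by (simp add: area_density_def strip_metric_def)

lemma conormal_strip_metric:
  assumes "0 < E (fst q)"
  shows "conormal (strip_metric E) l q = (0, if snd q = l then 1 else - 1)"
  unfolding conormal_def
proof (rule the_equality)
  fix v assume v: "strip_metric E q v v = 1 \<and> strip_metric E q v (1, 0) = 0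
    \<and> (if snd q = l then snd v > 0 else snd v < 0)"
  then have "fst v = 0" using assms by (auto simp: strip_metric_def)
  with v have "snd v * snd v = 1" by (simp add: strip_metric_def)
  then have "snd v = 1 \<or> snd v = - 1" by (simp add: square_eq_1_iff)
  with v \<open>fst v = 0\<close> show "v = (0, if snd q = l then 1 else - 1)"
    by (auto simp: prod_eq_iff)
qed (auto simp: strip_metric_def)

text \<open>Differentiating \<open>us / E\<close> gives \<open>- us * E' / E\<^sup>2\<close>, and
  the Christoffel term of the divergence restores half of it.\<close>

lemma laplacian_strip_metric:
  assumes u: "smooth_on V u" and q: "q \<in> V"
    and E: "\<And>s. 0 < E s" and E': "(E has_real_derivative E') (at (fst q))"
  defines "us \<equiv> \<lambda>q. frechet_derivative u (at q) (1, 0)"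
    and "ut \<equiv> \<lambda>q. frechet_derivative u (at q) (0, 1)"
  shows "laplacian (strip_metric E) u q
    = frechet_derivative us (at q) (1, 0) / E (fst q) - us q * E' / (2 * (E (fst q))\<^sup>2)
      + frechet_derivative ut (at q) (0, 1)"
proof -
  let ?Y = "\<lambda>q. (us q / E (fst q), ut q)"
  have V: "open V" using u by (rule smooth_on_open)
  have grad: "gradient (strip_metric E) u p = ?Y p" if "p \<in> V" for p
    unfolding gradient_def us_def ut_def
    using E[of "fst p"] smooth_on_differentiable[OF u that]
    by (subst sharp_strip_metric) (auto intro: linear_frechet_derivative)
  have dus: "(us has_derivative frechet_derivative us (at q)) (at q)"
    and dut: "(ut has_derivative frechet_derivative ut (at q)) (at q)"
    unfolding us_def ut_def
    by (intro has_derivative_frechet smooth_on_differentiable[OF smooth_on_frechet[OF u]] q)+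
  have dE: "((\<lambda>q. E (fst q)) has_derivative (\<lambda>v. E' * fst v)) (at q)"
    using diff_chain_at[OF bounded_linear_imp_has_derivative[OF bounded_linear_fst]
        E'[unfolded has_field_derivative_def]] by (simp add: o_def)
  have nz: "E (fst q) \<noteq> 0" using E[of "fst q"] by simp
  have "frechet_derivative (gradient (strip_metric E) u) (at q) = frechet_derivative ?Y (at q)"
    by (rule frechet_derivative_cong_open[OF V q grad])
  moreover have "(?Y has_derivative (\<lambda>v. ((frechet_derivative us (at q) v * E (fst q)
      - us q * (E' * fst v)) / (E (fst q) * E (fst q)), frechet_derivative ut (at q) v))) (at q)"
    by (intro has_derivative_Pair has_derivative_divide' dus dut dE nz)
  ultimately have "frechet_derivative (gradient (strip_metric E) u) (at q) v
    = ((frechet_derivative us (at q) v * E (fst q) - us q * (E' * fst v))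
        / (E (fst q) * E (fst q)), frechet_derivative ut (at q) v)" for v
    by (simp add: frechet_derivativeI)
  then show ?thesis
    unfolding laplacian_def trace_of_real_times_real covd_def grad[OF q]
      christoffel_strip_metric[OF nz E']
    using nz by (simp add: field_simps power2_eq_square)
qed

text \<open>Slices are totally geodesic: the normal field does not change in horizontal directions,
  and the Christoffel form of a vertical vector vanishes.\<close>

lemma second_ff_slice:
  assumes "Im (fst p) \<noteq> 0" "\<kappa> \<noteq> 0" "snd v = 0"
  shows "second_ff (product_metric \<kappa>) (\<lambda>p. p) (\<lambda>p. - (0, 2 * snd p / L - 1)) p v v = 0"
proof -
  have "((\<lambda>p::complex \<times> real. - (0::complex, 2 * snd p / L - 1)) has_derivative
      (\<lambda>v. - (0, 2 * snd v / L - 0))) (at p)"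
    by (intro has_derivative_minus has_derivative_Pair has_derivative_const has_derivative_diff
        bounded_linear_imp_has_derivative bounded_linear_divide[THEN bounded_linear_compose]
        bounded_linear_const_mult bounded_linear_snd)
  from frechet_derivativeI[OF this] assms show ?thesis
    by (simp add: second_ff_def covd_def christoffel_product_metric product_metric_def
        hyp_metric_def chr_form_def zero_prod_def)
qed

section \<open>The second variation of the cylinder\<close>

context cgc_curve
begin

text \<open>The explicit quotient makes continuity of the derivative visible, as needed to integrate
  the terms that contain it.\<close>

definition E' :: "real \<Rightarrow> real" where
  "E' s = (2 * (Re (\<alpha>' s) * Re (\<alpha>'' s) + Im (\<alpha>' s) * Im (\<alpha>'' s)) * (a * Im (\<alpha> s))\<^sup>2
    - (r s)\<^sup>2 * (2 * (a * Im (\<alpha>' s) * (a * Im (\<alpha> s))))) / ((a * Im (\<alpha> s))\<^sup>2 * (a * Im (\<alpha> s))\<^sup>2)"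

lemma DERIV_E: "(E has_real_derivative E' s) (at s)"
proof -
  have "(a * Im (\<alpha> s))\<^sup>2 \<noteq> 0" using a_pos Im_pos[of s] by simp
  from DERIV_divide[OF DERIV_power[OF DERIV_r[of s], of 2]
      DERIV_power[OF DERIV_cmult[OF DERIV_Im(1)[of s], of a], of 2] this]
  show ?thesis
    unfolding E_def[abs_def]
    by (rule DERIV_cong) (use r_pos[of s] in \<open>simp add: E'_def\<close>)
qed

lemma continuous_on_E': "continuous_on UNIV E'"
proof -
  have "continuous_on UNIV \<alpha>''"
    using smooth_on_continuous_on[OF smooth_on_frechet[OF smooth_\<alpha>', of 1]] by (simp add: frechet_\<alpha>')
  moreover have "continuous_on UNIV \<alpha>'" by (rule smooth_on_continuous_on[OF smooth_\<alpha>'])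
  ultimately show ?thesis
    unfolding E'_def[abs_def] using a_pos Im_pos
    by (intro continuous_intros continuous_on_r continuous_on_\<alpha>) (auto simp: less_imp_neq[symmetric])
qed

lemma q_coeff_X: "q_coeff g X L (N w) (Nt L) (\<lambda>q. - N w q) (pi / 2) q = 0"
  using second_ff_slice[of "X q" \<kappa> "- N w q" L] neg Im_pos[of "fst q"]
  by (simp add: q_coeff_def Nt_def[abs_def] cylinder_param_def N_def)

lemma jacobi_op_X:
  assumes "smooth_on V u" "q \<in> V" "w\<^sup>2 = 1"
  shows "jacobi_op g X (N w) u q
    = frechet_derivative (\<lambda>q. frechet_derivative u (at q) (1, 0)) (at q) (1, 0) / E (fst q)
      - frechet_derivative u (at q) (1, 0) * E' (fst q) / (2 * (E (fst q))\<^sup>2)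
      + frechet_derivative (\<lambda>q. frechet_derivative u (at q) (0, 1)) (at q) (0, 1)
      + (\<kappa>\<^sub>g\<^sup>2 + \<kappa>) * u q"
  by (simp add: jacobi_op_def first_ff_X laplacian_strip_metric[OF assms(1,2) E_pos DERIV_E]
      norm_sff_sq_X[OF assms(3)] Ric_X[OF assms(3)])

text \<open>Integration by parts: the integrand of the second variation is dominated by the divergence
  \<open>\<partial>\<^sub>s (u u\<^sub>s / v) + \<partial>\<^sub>t (v u u\<^sub>t)\<close> with \<open>v = sqrt E\<close>, because the remaining terms are
  \<open>- u\<^sub>s\<^sup>2 / v\<close>, \<open>- v u\<^sub>t\<^sup>2\<close> and \<open>(\<kappa>\<^sub>g\<^sup>2 + \<kappa>) v u\<^sup>2\<close>.\<close>

lemma second_variation_nonneg: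
  assumes L: "0 < L" and w: "w\<^sup>2 = 1" and u: "test_function L u"
  shows "0 \<le> second_variation g X L (N w) (Nt L) (\<lambda>q. - N w q) (pi / 2) u"
proof -
  obtain V where V: "strip L \<subseteq> V" "smooth_on V u"
    using u by (auto simp: test_function_def smooth_near_def)
  obtain K where K: "compact K" "\<And>q. q \<in> strip L - K \<Longrightarrow> u q = 0"
    using u by (auto simp: test_function_def)
  \<comment> \<open>The bound on \<open>K\<close> is strict, so \<open>u\<close> vanishes on the
    strip already at \<open>\<bar>s\<bar> = R\<close>, where the boundary terms of the box
    lie.\<close>
  obtain R where "0 < R" and R: "\<And>q. q \<in> K \<Longrightarrow> norm q < R"
    using compact_imp_bounded[OF K(1)] by (meson bounded_pos_less)
  define us where "us = (\<lambda>q. frechet_derivative u (at q) (1, 0))"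
  define ut where "ut = (\<lambda>q. frechet_derivative u (at q) (0, 1))"
  define uss where "uss = (\<lambda>q. frechet_derivative us (at q) (1, 0))"
  define utt where "utt = (\<lambda>q. frechet_derivative ut (at q) (0, 1))"
  define v where "v s = sqrt (E s)" for s
  have v: "0 < v s" "E s = (v s)\<^sup>2" for s using E_pos[of s] by (simp_all add: v_def)
  have sm: "smooth_on V us" "smooth_on V ut" "smooth_on V uss" "smooth_on V utt"
    unfolding us_def ut_def uss_def utt_def using V(2) by (auto intro!: smooth_on_frechet)
  have zero: "u (s, t) = 0" if "0 \<le> t" "t \<le> L" "R \<le> \<bar>s\<bar>" for s t
  proof (rule K(2))
    have "\<bar>s\<bar> \<le> norm (s, t)" using norm_fst_le[of s t] by simp
    then show "(s, t) \<in> strip L - K" using R[of "(s, t)"] that by (auto simp: strip_def)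
  qed
  let ?B = "cbox (- R, 0) (R, L)"
  have B: "?B = {-R..R} \<times> {0..L}" by (simp add: cbox_Pair_eq)
  have BV: "?B \<subseteq> V" using V(1) by (auto simp: B strip_def)
  have inV: "(s, t) \<in> V" if "t \<in> {0..L}" for s t
    using V(1) that by (auto simp: strip_def)
  have Dv: "(v has_real_derivative E' s / (2 * v s)) (at s)" for s
  proof -
    have "((\<lambda>s. sqrt (E s)) has_real_derivative inverse (sqrt (E s)) / 2 * E' s) (at s)"
      by (rule DERIV_chain2[where f = sqrt and g = E and x = s, OF DERIV_real_sqrt[OF E_pos] DERIV_E])
    then show ?thesis unfolding v_def[abs_def] by (simp add: inverse_eq_divide mult.commute)
  qed
  have Cv: "continuous_on S (\<lambda>q. v (fst q))" "continuous_on S (\<lambda>q. E' (fst q))"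
    for S :: "(real \<times> real) set"
  proof -
    have "continuous_on UNIV v"
      using DERIV_isCont[OF Dv] by (simp add: continuous_at_imp_continuous_on)
    then show "continuous_on S (\<lambda>q. v (fst q))" "continuous_on S (\<lambda>q. E' (fst q))"
      using continuous_on_fst[OF continuous_on_id] continuous_on_E'
      by (auto intro: continuous_on_compose2)
  qed
  have Cu: "continuous_on ?B f" if "smooth_on V f" for f :: "real \<times> real \<Rightarrow> real"
    using smooth_on_continuous_on[OF that] BV continuous_on_subset by blast
  note Cus = Cu[OF V(2)] Cu[OF sm(1)] Cu[OF sm(2)] Cu[OF sm(3)] Cu[OF sm(4)]
  define F where "F q = u q * (uss q / E (fst q) - us q * E' (fst q) / (2 * (E (fst q))\<^sup>2) + utt q
      + (\<kappa>\<^sub>g\<^sup>2 + \<kappa>) * u q) * v (fst q)" for q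
  \<comment> \<open>\<open>\<Phi>\<close> and \<open>\<Psi>\<close> are the two divergence terms in
    expanded form; the derivative of \<open>1 / v\<close> accounts for
    \<open>v (fst q) ^ 3\<close>.\<close>
  define \<Phi> where "\<Phi> q = ((us q)\<^sup>2 + u q * uss q) / v (fst q)
      - u q * us q * E' (fst q) / (2 * v (fst q) ^ 3)" for q
  define \<Psi> where "\<Psi> q = ((ut q)\<^sup>2 + u q * utt q) * v (fst q)" for q
  have vnz: "v s \<noteq> 0" "E s \<noteq> 0" for s using v[of s] by auto
  have CF: "continuous_on ?B F"
    unfolding F_def v(2) by (intro continuous_intros Cus Cv) (auto simp: vnz)
  have C\<Phi>: "continuous_on ?B \<Phi>"
    unfolding \<Phi>_def by (intro continuous_intros Cus Cv) (auto simp: vnz)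
  have C\<Psi>: "continuous_on ?B \<Psi>"
    unfolding \<Psi>_def by (intro continuous_intros Cus Cv)
  have Dus: "((\<lambda>s. u (s, t)) has_real_derivative us (s, t)) (at s)"
    "((\<lambda>s. us (s, t)) has_real_derivative uss (s, t)) (at s)"
    "((\<lambda>t. u (s, t)) has_real_derivative ut (s, t)) (at t)"
    "((\<lambda>t. ut (s, t)) has_real_derivative utt (s, t)) (at t)" if "t \<in> {0..L}" for s t
  proof -
    have V': "u differentiable (at (s, t))" "us differentiable (at (s, t))" "ut differentiable (at (s, t))"
      using smooth_on_differentiable inV[OF that] V(2) sm by auto
    show "((\<lambda>s. u (s, t)) has_real_derivative us (s, t)) (at s)"
      using DERIV_fst_slice[OF V'(1)] by (simp add: us_def)
    show "((\<lambda>s. us (s, t)) has_real_derivative uss (s, t)) (at s)"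
      using DERIV_fst_slice[OF V'(2)] by (simp add: uss_def)
    show "((\<lambda>t. u (s, t)) has_real_derivative ut (s, t)) (at t)"
      using DERIV_snd_slice[OF V'(1)] by (simp add: ut_def)
    show "((\<lambda>t. ut (s, t)) has_real_derivative utt (s, t)) (at t)"
      using DERIV_snd_slice[OF V'(3)] by (simp add: utt_def)
  qed
  have le: "F q \<le> \<Phi> q + \<Psi> q" for q
  proof -
    let ?v = "v (fst q)"
    have "\<Phi> q + \<Psi> q - F q = (us q)\<^sup>2 / ?v + (ut q)\<^sup>2 * ?v - (\<kappa>\<^sub>g\<^sup>2 + \<kappa>) * (u q)\<^sup>2 * ?v"
      unfolding F_def \<Phi>_def \<Psi>_def v(2) using vnz(1)[of "fst q"]
      by (simp add: field_simps power2_eq_square power3_eq_cube)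
    moreover have "0 \<le> (us q)\<^sup>2 / ?v" "0 \<le> (ut q)\<^sup>2 * ?v" "(\<kappa>\<^sub>g\<^sup>2 + \<kappa>) * (u q)\<^sup>2 * ?v \<le> 0"
      using bound v(1)[of "fst q"] by (auto intro!: mult_nonpos_nonneg)
    ultimately show ?thesis by linarith
  qed
  have \<Phi>0: "integral ?B \<Phi> = 0"
  proof -
    have int: "integral {-R..R} (\<lambda>s. \<Phi> (s, t)) = 0" if t: "t \<in> {0..L}" for t
    proof -
      have "((\<lambda>s. \<Phi> (s, t)) has_integral (u (R, t) * us (R, t) / v R - u (-R, t) * us (-R, t) / v (-R))) {-R..R}"
      proof (rule fundamental_theorem_of_calculus)
        fix s assume "s \<in> {-R..R}"
        have "((\<lambda>s. u (s, t) * us (s, t) / v s) has_real_derivative \<Phi> (s, t)) (at s)"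
          by (rule DERIV_cong[OF DERIV_divide[OF DERIV_mult[OF Dus(1)[OF t] Dus(2)[OF t]] Dv vnz(1)]])
            (use vnz(1)[of s] in \<open>simp add: \<Phi>_def field_simps power2_eq_square power3_eq_cube\<close>)
        then show "((\<lambda>s. u (s, t) * us (s, t) / v s) has_vector_derivative \<Phi> (s, t)) (at s within {-R..R})"
          by (simp add: has_real_derivative_iff_has_vector_derivative has_vector_derivative_at_within)
      qed (use \<open>0 < R\<close> in simp)
      moreover have "u (R, t) = 0" "u (-R, t) = 0" using zero[of t R] zero[of t "-R"] t by auto
      ultimately show ?thesis by (simp add: integral_unique)
    qed
    \<comment> \<open>The order of integration is exchanged, since \<open>\<Phi>\<close> is an exact
      derivative in the variable \<open>s\<close>.\<close>
    have "integral ?B \<Phi> = integral (cbox (- R) R) (\<lambda>s. integral (cbox 0 L) (\<lambda>t. \<Phi> (s, t)))"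
      using C\<Phi> by (rule integral_prod_continuous)
    also have "\<dots> = integral (cbox 0 L) (\<lambda>t. integral (cbox (- R) R) (\<lambda>s. \<Phi> (s, t)))"
      using C\<Phi> by (intro integral_swap_continuous) simp
    also have "\<dots> = integral (cbox 0 L) (\<lambda>t. 0)"
      using int by (intro Henstock_Kurzweil_Integration.integral_cong) simp
    finally show ?thesis by simp
  qed
  \<comment> \<open>The flux of \<open>v u ut\<close> through the level \<open>t\<close>. At the two
    ends of the strip it is, up to the sign of the conormal, the boundary term of the second
    variation.\<close>
  define b where "b t = integral {-R..R} (\<lambda>s. u (s, t) * ut (s, t) * v s)" for t
  have Cb: "continuous_on {-R..R} (\<lambda>s. u (s, t) * ut (s, t) * v s)" if t: "t \<in> {0..L}" for t
  proof -
    have C: "continuous_on {-R..R} (\<lambda>s. f (s, t))" if "smooth_on V f" for f :: "real \<times> real \<Rightarrow> real"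
      by (rule continuous_on_compose2[OF Cu[OF that]])
        (use t in \<open>auto intro!: continuous_intros simp: B\<close>)
    have "continuous_on {-R..R} v"
      using DERIV_isCont[OF Dv] by (simp add: continuous_at_imp_continuous_on)
    then show ?thesis
      by (intro continuous_on_mult C[OF V(2)] C[OF sm(2)])
  qed
  have \<Psi>: "integral ?B \<Psi> = b L - b 0"
  proof -
    have int: "integral {0..L} (\<lambda>t. \<Psi> (s, t)) = u (s, L) * ut (s, L) * v s - u (s, 0) * ut (s, 0) * v s" for s
    proof (rule integral_unique, rule fundamental_theorem_of_calculus)
      fix t assume t: "t \<in> {0..L}"
      have "((\<lambda>t. u (s, t) * ut (s, t) * v s) has_real_derivative \<Psi> (s, t)) (at t)"
        by (rule DERIV_cong[OF DERIV_cmult_right[OF DERIV_mult[OF Dus(3)[OF t] Dus(4)[OF t]]]])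
          (simp add: \<Psi>_def power2_eq_square mult.commute)
      then show "((\<lambda>t. u (s, t) * ut (s, t) * v s) has_vector_derivative \<Psi> (s, t)) (at t within {0..L})"
        by (simp add: has_real_derivative_iff_has_vector_derivative has_vector_derivative_at_within)
    qed (use L in simp)
    have "integral ?B \<Psi> = integral (cbox (- R) R) (\<lambda>s. integral (cbox 0 L) (\<lambda>t. \<Psi> (s, t)))"
      using C\<Psi> by (rule integral_prod_continuous)
    also have "\<dots> = integral {-R..R} (\<lambda>s. u (s, L) * ut (s, L) * v s - u (s, 0) * ut (s, 0) * v s)"
      by (simp add: int)
    also have "\<dots> = b L - b 0"
      unfolding b_def
      by (intro Henstock_Kurzweil_Integration.integral_diff integrable_continuous_real Cb)
        (use L in auto)
    finally show ?thesis .
  qed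
  have "integral ?B F \<le> integral ?B (\<lambda>q. \<Phi> q + \<Psi> q)"
    using le by (intro integral_le integrable_continuous continuous_on_add CF C\<Phi> C\<Psi>) auto
  also have "\<dots> = b L - b 0"
    using integrable_continuous[OF C\<Phi>] integrable_continuous[OF C\<Psi>]
    by (simp add: Henstock_Kurzweil_Integration.integral_add \<Phi>0 \<Psi>)
  finally have main: "integral ?B F \<le> b L - b 0" .
  \<comment> \<open>On the strip outside the box the factor \<open>u q\<close> vanishes, which
    annihilates the integrand whatever the value of the Jacobi operator there.\<close>
  have I1: "(LINT q:strip L|lborel. u q * jacobi_op g X (N w) u q * area_density (first_ff g X) q)
      = integral ?B F"
    unfolding set_lebesgue_integral_def
  proof (rule lborel_integral_eq_integral_compact[OF _ CF])
    fix q
    have F: "u q * jacobi_op g X (N w) u q * area_density (first_ff g X) q = F q" if "q \<in> V"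
      using that by (simp add: jacobi_op_X[OF V(2) _ w] first_ff_X area_density_strip_metric F_def v_def
          us_def ut_def uss_def utt_def)
    show "indicator (strip L) q *\<^sub>R (u q * jacobi_op g X (N w) u q * area_density (first_ff g X) q) = F q"
      if "q \<in> ?B"
    proof -
      have "q \<in> strip L" using that by (auto simp: B strip_def)
      then show ?thesis using F BV that by auto
    qed
    show "indicator (strip L) q *\<^sub>R (u q * jacobi_op g X (N w) u q * area_density (first_ff g X) q) = 0"
      if "q \<notin> ?B"
    proof (cases "q \<in> strip L")
      case True
      then have "R \<le> \<bar>fst q\<bar>" using that by (cases q) (auto simp: B strip_def)
      then have "u q = 0" using zero[of "snd q" "fst q"] True by (cases q) (auto simp: strip_def)
      then show ?thesis by simp
    qed simp
  qed simp
  have I2: "(LINT s|lborel. u (s, t) * (frechet_derivative u (at (s, t)) (conormal (first_ff g X) L (s, t))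
        - q_coeff g X L (N w) (Nt L) (\<lambda>q. - N w q) (pi / 2) (s, t) * u (s, t))
      * sqrt (first_ff g X (s, t) (1, 0) (1, 0))) = (if t = L then b t else - b t)" if t: "t \<in> {0, L}" for t
  proof -
    have t': "t \<in> {0..L}" using t L by auto
    have "(LINT s|lborel. u (s, t) * (frechet_derivative u (at (s, t)) (conormal (first_ff g X) L (s, t))
        - q_coeff g X L (N w) (Nt L) (\<lambda>q. - N w q) (pi / 2) (s, t) * u (s, t))
      * sqrt (first_ff g X (s, t) (1, 0) (1, 0)))
      = integral {-R..R} (\<lambda>s. (if t = L then 1 else - 1) * (u (s, t) * ut (s, t) * v s))"
    proof (rule lborel_integral_eq_integral_compact)
      show "continuous_on {-R..R} (\<lambda>s. (if t = L then 1 else - 1) * (u (s, t) * ut (s, t) * v s))"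
        by (intro continuous_on_mult_left Cb t')
      fix s
      \<comment> \<open>At the level 0 the exterior conormal is \<open>(0, - 1)\<close>; linearity
        turns the derivative in this direction into \<open>- ut\<close>.\<close>
      have "linear (frechet_derivative u (at (s, t)))"
        by (intro linear_frechet_derivative smooth_on_differentiable[OF V(2)] inV t')
      then have "frechet_derivative u (at (s, t)) (0, - 1) = - ut (s, t)"
        using linear_neg[of "frechet_derivative u (at (s, t))" "(0, 1)"] by (simp add: ut_def)
      then show "u (s, t) * (frechet_derivative u (at (s, t)) (conormal (first_ff g X) L (s, t))
        - q_coeff g X L (N w) (Nt L) (\<lambda>q. - N w q) (pi / 2) (s, t) * u (s, t))
      * sqrt (first_ff g X (s, t) (1, 0) (1, 0))
        = (if t = L then 1 else - 1) * (u (s, t) * ut (s, t) * v s)"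
        by (simp add: first_ff_X conormal_strip_metric E_pos q_coeff_X strip_metric_def v_def ut_def)
      show "u (s, t) * (frechet_derivative u (at (s, t)) (conormal (first_ff g X) L (s, t))
        - q_coeff g X L (N w) (Nt L) (\<lambda>q. - N w q) (pi / 2) (s, t) * u (s, t))
      * sqrt (first_ff g X (s, t) (1, 0) (1, 0)) = 0" if "s \<notin> {-R..R}"
      proof -
        have "R \<le> \<bar>s\<bar>" using that by auto
        then show ?thesis using zero[of t s] t' by simp
      qed
    qed simp
    also have "\<dots> = (if t = L then b t else - b t)" by (simp add: b_def)
    finally show ?thesis .
  qed
  have "second_variation g X L (N w) (Nt L) (\<lambda>q. - N w q) (pi / 2) u
    = - integral ?B F + (\<Sum>t\<in>{0, L}. if t = L then b t else - b t)"
    unfolding second_variation_def Let_def I1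
      by (intro arg_cong2[where f = "(+)"] refl sum.cong I2)
  also have "\<dots> = - integral ?B F + (b L - b 0)" using L by simp
  finally show ?thesis using main by simp
qed

end

theorem theorem5p1:
  fixes \<kappa> \<kappa>\<^sub>g L :: real and \<alpha> :: "real \<Rightarrow> complex"
  assumes "\<kappa> < 0"
    and "regular_curve \<alpha>"
    and "complete_curve \<kappa> \<alpha>"
    and "\<forall>s. geodesic_curvature \<kappa> \<alpha> s = \<kappa>\<^sub>g"
    and "\<kappa>\<^sub>g\<^sup>2 + \<kappa> \<le> 0"
    and "0 < L"
  shows "strongly_stable (product_metric \<kappa>) product_space (slab L)
           (truncated_cylinder \<alpha> L) (cylinder_param \<alpha>) L"
proof -
  interpret cgc_curve \<kappa> \<kappa>\<^sub>g \<alpha>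
    using assms by unfold_locales auto
  show ?thesis
    unfolding strongly_stable_def
  proof (intro conjI ballI)
    show "cylinder_param \<alpha> ` strip L = truncated_cylinder \<alpha> L"
      by (rule cylinder_param_image)
    show "card (components (slab L - truncated_cylinder \<alpha> L)) = 2"
      unfolding components_slab[OF assms(6)] using sides_distinct[OF assms(6)] by simp
    fix D assume "D \<in> components (slab L - truncated_cylinder \<alpha> L)"
    \<comment> \<open>The component determines the sign \<open>w\<close>, and with it the normal
      pointing into that component.\<close>
    then obtain w where w: "w = 1 \<or> w = - 1" "D = side w \<times> {0..L}"
      unfolding components_slab[OF assms(6)] by blast
    then have "w\<^sup>2 = 1" by auto
    then show "\<exists>N Nt \<nu>t \<gamma>. capillary_surface g product_space (slab L) X L D N Nt \<nu>t \<gamma>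
        \<and> (\<forall>u. test_function L u \<longrightarrow> 0 \<le> second_variation g X L N Nt \<nu>t \<gamma> u)"
      using capillary_cylinder[OF assms(6) w(1)] second_variation_nonneg[OF assms(6)]
      unfolding w(2) by blast
  qed
qed

end
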